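(* Let $z_0,z_1\in\mathbb C^*$. With the identification of $\mathrm{Aut}^{\otimes}(\omega)$ with $\mathbf Z^{alg}=\mathrm{Hom}_{grp}(\mathbb C^*,\mathbb C^* )\times\mathbb C$, and viewing $\mathrm{Iso}^{\otimes}(\omega^{(0)}_{z_0},\omega^{(0)}_{z_1})$ as a subset of $\mathrm{Aut}^{\otimes}(\omega)$ by restriction along $\mathcal R\to\mathcal P^{(0)}$, one has $$\mathrm{Iso}^{\otimes}(\omega^{(0)}_{z_0},\omega^{(0)}_{z_1})=\{(\gamma,\lambda)\in\mathbf Z^{alg}\;:\;\gamma(q)\,z_0=z_1\}.$$
   Context: Fix $q\in\mathbb C$ with $|q|>1$; for a matrix $F$ of functions of $z$, $(\sigma_qF)(z)=F(qz)$. $\mathbb C(\{z\})$ is the field of germs at $0$ of meromorphic functions. $\mathcal P^{(0)}$ is the category whose objects are pairs $(\mathbb C^n,A)$ with $n\in\mathbb N$, $A\in GL_n(\mathbb C)$, and whose morphisms $(\mathbb C^n,A)\to(\mathbb C^p,B)$ are the matrices $F\in M_{p,n}(\mathbb C(\{z\}))$ such that $(\sigma_qF)A=BF$. Tensor products of objects and morphisms are Kronecker products; the unit is $(\mathbb C,1)$. Every morphism of $\mathcal P^{(0)}$ has entries in $\mathbb C[z,z^{-1}]$. For $z_0\in\mathbb C^*$, $\omega^{(0)}_{z_0}$ is the fibre functor on $\mathcal P^{(0)}$ (to finite-dimensional $\mathbb C$-vector spaces) given by $(\mathbb C^n,A)\mapsto\mathbb C^n$, $F\mapsto F(z_0)$.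 $\mathcal R$ is the tannakian category of finite-dimensional complex representations of $\mathbb Z$: objects $(\mathbb C^n,A)$ with $A\in GL_n(\mathbb C)$, morphisms the constant matrices $F\in M_{p,n}(\mathbb C)$ with $FA=BF$; $\omega$ is its forgetful functor. There is an obvious embedding $\mathcal R\to\mathcal P^{(0)}$ (same objects, fewer morphisms), and each $\omega^{(0)}_{z_0}$ restricts to $\omega$ on $\mathcal R$; this makes $\mathrm{Iso}^{\otimes}(\omega^{(0)}_{z_0},\omega^{(0)}_{z_1})$ a subset of $\mathrm{Aut}^{\otimes}(\omega)$. $\mathrm{Aut}^{\otimes}(\omega)$ is identified with $\mathbf Z^{alg}=\mathrm{Hom}_{grp}(\mathbb C^*,\mathbb C^* )\times\mathbb C$ (all abstract group homomorphisms) as follows: $(\gamma,\lambda)$ acts on $\omega(\mathbb C^n,A)=\mathbb C^n$ by the matrix $\gamma(A_s)A_u^{\lambda}$, where $A=A_sA_u$ is the multiplicative Dunford (Jordan) decomposition, $\gamma(A_s)=Q\,\mathrm{diag}(\gamma(c_1),\dots,\gamma(c_n))\,Q^{-1}$ if $A_s=Q\,\mathrm{diag}(c_1,\dots,c_n)\,Q^{-1}$, and $A_u^{\lambda}=\sum_{k\ge0}\binom{\lambda}{k}(A_u-I_n)^k$. *)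

theory Defs
  imports
    "HOL-Complex_Analysis.Complex_Analysis"
    "HOL-Algebra.Group"
    "HOL-Library.FuncSet"
    "Jordan_Normal_Form.Matrix"
begin

section \<open>Germs at 0 of meromorphic functions\<close>

text \<open>A germ at \<open>0\<close> of a meromorphic function is represented by its convergent Laurent expansion;
  the lemmas below relate this to actual functions.\<close>

definition mero_germs :: "complex fls set" where
  "mero_germs = {f. fls_conv_radius f > 0}"

lemma mero_germs_iff: "f \<in> mero_germs \<longleftrightarrow> (\<exists>g. g meromorphic_on {0} \<and> g has_laurent_expansion f)"
proof
  assume "f \<in> mero_germs"
  then have "eval_fls f has_laurent_expansion f"
    by (simp add: mero_germs_def has_laurent_expansion_def)
  then show "\<exists>g. g meromorphic_on {0} \<and> g has_laurent_expansion f"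
    by (auto simp: meromorphic_on_def)
next
  assume "\<exists>g. g meromorphic_on {0} \<and> g has_laurent_expansion f"
  then show "f \<in> mero_germs"
    by (auto simp: mero_germs_def has_laurent_expansion_def)
qed

lemma meromorphic_at_0_iff: "g meromorphic_on {0} \<longleftrightarrow> (\<exists>f\<in>mero_germs. g has_laurent_expansion f)"
  by (auto simp: meromorphic_on_def mero_germs_def has_laurent_expansion_def)

text \<open>The operator sending \<open>f(z)\<close> to \<open>f(q z)\<close>.\<close>

definition sigma :: "complex \<Rightarrow> complex fls \<Rightarrow> complex fls" where
  "sigma q f = fls_compose_fps f (fps_const q * fps_X)"

lemma has_laurent_expansion_sigma:
  assumes "q \<noteq> 0" "g has_laurent_expansion f"
  shows "(\<lambda>z. g (q * z)) has_laurent_expansion sigma q f"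
proof -
  have "(\<lambda>z. q * z) has_laurent_expansion fps_to_fls (fps_const q * fps_X)"
    by (intro has_laurent_expansion_fps fps_expansion_intros)
  from has_laurent_expansion_compose[OF assms(2) this] assms(1) show ?thesis
    by (simp add: sigma_def o_def)
qed


section \<open>The categories and their fibre functors\<close>

text \<open>An object \<open>(\<complex>\<^sup>n, A)\<close> is represented by the invertible matrix \<open>A\<close>, whose dimension determines \<open>n\<close>
  (\<open>n = 0\<close> is allowed). Both categories have the same objects.\<close>

definition objects :: "complex mat set" where
  "objects = {A. invertible_mat A}"

definition hom_P0 :: "complex \<Rightarrow> complex mat \<Rightarrow> complex mat \<Rightarrow> complex fls mat set" where
  "hom_P0 q A B = {F \<in> carrier_mat (dim_row B) (dim_row A).
     elements_mat F \<subseteq> mero_germs \<and>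
     map_mat (sigma q) F * map_mat fls_const A = map_mat fls_const B * F}"

definition hom_R :: "complex mat \<Rightarrow> complex mat \<Rightarrow> complex mat set" where
  "hom_R A B = {F \<in> carrier_mat (dim_row B) (dim_row A). F * A = B * F}"

text \<open>The action of the fibre functor at \<open>z\<^sub>0\<close> on morphisms. The entries of a morphism are Laurent
  polynomials, so that their Laurent series can be evaluated at every \<open>z\<^sub>0 \<noteq> 0\<close>.\<close>

definition fibre_P0 :: "complex \<Rightarrow> complex fls mat \<Rightarrow> complex mat" where
  "fibre_P0 z0 F = map_mat (\<lambda>f. eval_fls f z0) F"

definition kronecker :: "'a::times mat \<Rightarrow> 'a mat \<Rightarrow> 'a mat" where
  "kronecker A B = mat (dim_row A * dim_row B) (dim_col A * dim_col B)
     (\<lambda>(i, j). A $$ (i div dim_row B, j div dim_col B) * B $$ (i mod dim_row B, j mod dim_col B))"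

text \<open>Tensor-compatible natural isomorphisms between two fibre functors on a category with the above
  objects and tensor product, both functors sending \<open>(\<complex>\<^sup>n, A)\<close> to \<open>\<complex>\<^sup>n\<close> and given on morphisms by
  \<open>\<omega>\<close> and \<open>\<omega>'\<close>.\<close>

definition tensor_isos ::
    "(complex mat \<Rightarrow> complex mat \<Rightarrow> 'm set) \<Rightarrow> ('m \<Rightarrow> complex mat) \<Rightarrow> ('m \<Rightarrow> complex mat)
      \<Rightarrow> (complex mat \<Rightarrow> complex mat) set" where
  "tensor_isos Hom \<omega> \<omega>' = {\<phi> \<in> extensional objects.
     (\<forall>A\<in>objects. \<phi> A \<in> carrier_mat (dim_row A) (dim_row A) \<and> invertible_mat (\<phi> A)) \<and>
     (\<forall>A\<in>objects. \<forall>B\<in>objects. \<forall>F\<in>Hom A B. \<omega>' F * \<phi> A = \<phi> B * \<omega> F) \<and>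
     (\<forall>A\<in>objects. \<forall>B\<in>objects. \<phi> (kronecker A B) = kronecker (\<phi> A) (\<phi> B)) \<and>
     \<phi> (1\<^sub>m 1) = 1\<^sub>m 1}"

definition Iso_P0 :: "complex \<Rightarrow> complex \<Rightarrow> complex \<Rightarrow> (complex mat \<Rightarrow> complex mat) set" where
  "Iso_P0 q z0 z1 = tensor_isos (hom_P0 q) (fibre_P0 z0) (fibre_P0 z1)"

definition Aut_R :: "(complex mat \<Rightarrow> complex mat) set" where
  "Aut_R = tensor_isos hom_R (\<lambda>F. F) (\<lambda>F. F)"

text \<open>Since the embedding of the constant matrices is the identity on objects, restriction of a natural
  transformation along it leaves the family of matrices unchanged.\<close>

lemma eval_fls_const' [simp]: "eval_fls (fls_const c) z = c"
  by (cases "c = 0") (auto simp: eval_fls_def)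

lemma sigma_const [simp]: "sigma q (fls_const c) = fls_const c"
  by (simp add: sigma_def)

lemma fls_const_sum: "fls_const (sum f A) = (\<Sum>x\<in>A. fls_const (f x))"
  by (induction A rule: infinite_finite_induct) (auto simp flip: fls_plus_const)

lemma map_mat_fls_const_mult:
  assumes "dim_col A = dim_row B"
  shows "map_mat fls_const (A * B) = map_mat fls_const A * map_mat fls_const (B :: complex mat)"
  using assms by (intro eq_matI) (auto simp: scalar_prod_def fls_const_sum fls_const_mult_const)

lemma hom_R_embeds:
  assumes "A \<in> objects" "B \<in> objects" "F \<in> hom_R A B"
  shows "map_mat fls_const F \<in> hom_P0 q A B"
proof -
  have [simp]: "map_mat (sigma q) (map_mat fls_const F) = map_mat fls_const F"
    by (intro eq_matI) auto
  have "dim_col F = dim_row A" "dim_col B = dim_row F"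
    using assms by (auto simp: hom_R_def objects_def invertible_mat_def)
  with assms show ?thesis
    by (auto simp: hom_P0_def hom_R_def mero_germs_def elements_mat_def
        simp flip: map_mat_fls_const_mult)
qed

lemma fibre_P0_const: "fibre_P0 z0 (map_mat fls_const F) = F"
  by (intro eq_matI) (auto simp: fibre_P0_def)

lemma Iso_P0_subset_Aut_R: "Iso_P0 q z0 z1 \<subseteq> Aut_R"
proof
  fix \<phi> assume \<phi>: "\<phi> \<in> Iso_P0 q z0 z1"
  have "F * \<phi> A = \<phi> B * F" if "A \<in> objects" "B \<in> objects" "F \<in> hom_R A B" for A B F
  proof -
    have "fibre_P0 z1 (map_mat fls_const F) * \<phi> A = \<phi> B * fibre_P0 z0 (map_mat fls_const F)"
      using \<phi> that hom_R_embeds[OF that, of q] unfolding Iso_P0_def tensor_isos_def by blast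
    then show ?thesis
      by (simp add: fibre_P0_const)
  qed
  with \<phi> show "\<phi> \<in> Aut_R"
    unfolding Iso_P0_def Aut_R_def tensor_isos_def by blast
qed


section \<open>The proalgebraic hull of the integers\<close>

definition Cstar :: "complex monoid" where
  "Cstar = \<lparr>carrier = - {0}, mult = (*), one = 1\<rparr>"

definition Zalg :: "((complex \<Rightarrow> complex) \<times> complex) set" where
  "Zalg = (hom Cstar Cstar \<inter> extensional (carrier Cstar)) \<times> UNIV"

text \<open>Multiplicative Dunford decomposition \<open>A = S U = U S\<close>, with \<open>S\<close> diagonalisable and \<open>U\<close> unipotent.\<close>

definition dunford :: "complex mat \<Rightarrow> complex mat \<Rightarrow> complex mat \<Rightarrow> bool" where
  "dunford A S U \<longleftrightarrow> (let n = dim_row A in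
     {A, S, U} \<subseteq> carrier_mat n n \<and> A = S * U \<and> S * U = U * S \<and>
     (\<exists>c. similar_mat S (mat_diag n c)) \<and> (\<exists>k. (U - 1\<^sub>m n) ^\<^sub>m k = 0\<^sub>m n n))"

definition ss_part :: "complex mat \<Rightarrow> complex mat" where
  "ss_part A = (THE S. \<exists>U. dunford A S U)"

definition un_part :: "complex mat \<Rightarrow> complex mat" where
  "un_part A = (THE U. \<exists>S. dunford A S U)"

definition map_eigenvalues :: "(complex \<Rightarrow> complex) \<Rightarrow> complex mat \<Rightarrow> complex mat" where
  "map_eigenvalues \<gamma> S = (let n = dim_row S in THE M. \<exists>Q Q' c.
     similar_mat_wit S (mat_diag n c) Q Q' \<and> M = Q * mat_diag n (\<gamma> \<circ> c) * Q')"

text \<open>The binomial series, entry by entry; for unipotent \<open>U\<close> only finitely many terms are nonzero.\<close>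

definition unipotent_power :: "complex mat \<Rightarrow> complex \<Rightarrow> complex mat" where
  "unipotent_power U \<mu> = (let n = dim_row U in
     mat n n (\<lambda>(i, j). \<Sum>k. (\<mu> gchoose k) * ((U - 1\<^sub>m n) ^\<^sub>m k) $$ (i, j)))"

text \<open>The element of \<open>Aut_R\<close> identified with \<open>(\<gamma>, \<mu>)\<close>.\<close>

fun Zalg_aut :: "(complex \<Rightarrow> complex) \<times> complex \<Rightarrow> complex mat \<Rightarrow> complex mat" where
  "Zalg_aut (\<gamma>, \<mu>) =
     (\<lambda>A\<in>objects. map_eigenvalues \<gamma> (ss_part A) * unipotent_power (un_part A) \<mu>)"


text \<open>The parametrisation \<^const>\<open>Zalg_aut\<close> is injective: \<open>\<gamma>\<close> and \<open>\<mu>\<close> can be read off from the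
  action on \<open>c J\<close>, where \<open>J\<close> is the unipotent Jordan block of size 2.\<close>

definition scaled_block :: "complex \<Rightarrow> complex mat" where
  "scaled_block c = mat 2 2 (\<lambda>(i, j). if j < i then 0 else c)"

lemma lt_2_iff: "i < (2::nat) \<longleftrightarrow> i = 0 \<or> i = 1"
  by auto

lemma mult_mat_2:
  assumes "A \<in> carrier_mat 2 2" "B \<in> carrier_mat 2 2" "i < 2" "j < 2"
  shows "(A * B) $$ (i, j) = A $$ (i, 0) * B $$ (0, j) + A $$ (i, 1) * (B $$ (1, j) :: complex)"
  using assms by (simp add: scalar_prod_def numeral_2_eq_2)

lemma commute_scaled_block:
  assumes "A \<in> carrier_mat 2 2" "A * scaled_block c = scaled_block c * A" "c \<noteq> 0"
  shows "A $$ (1, 0) = 0" "A $$ (1, 1) = A $$ (0, 0)"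
proof -
  have c: "scaled_block c \<in> carrier_mat 2 2" by (simp add: scaled_block_def)
  have *: "(A * scaled_block c) $$ (i, j) = (scaled_block c * A) $$ (i, j)" for i j
    using assms by simp
  from *[of 0 0] *[of 0 1] assms(1,3) c show "A $$ (1, 0) = 0" "A $$ (1, 1) = A $$ (0, 0)"
    by (simp_all add: mult_mat_2 del: index_mult_mat(1), simp_all add: scaled_block_def)
qed

lemma upper_pow_00:
  assumes "N \<in> carrier_mat 2 2" "N $$ (1, 0) = (0 :: complex)"
  shows "(N ^\<^sub>m k) $$ (0, 0) = N $$ (0, 0) ^ k"
proof (induction k)
  case (Suc k)
  then show ?case
    using assms pow_carrier_mat[OF assms(1), of k] by (simp add: mult_mat_2 del: index_mult_mat(1))
qed (use assms in auto)

lemma similar_scalar: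
  fixes c :: complex
  assumes "similar_mat_wit (c \<cdot>\<^sub>m 1\<^sub>m n) D Q Q'"
  shows "D = c \<cdot>\<^sub>m 1\<^sub>m n"
proof -
  have 1: "Q * Q' = 1\<^sub>m n" "Q' * Q = 1\<^sub>m n" "c \<cdot>\<^sub>m 1\<^sub>m n = Q * D * Q'"
    "D \<in> carrier_mat n n" "Q \<in> carrier_mat n n" "Q' \<in> carrier_mat n n"
    using assms by (auto simp: similar_mat_wit_def Let_def)
  have "D = Q' * Q * D * (Q' * Q)"
    using 1 by simp
  also have "\<dots> = Q' * (Q * D * Q') * Q"
    using 1(4-6) by (simp add: assoc_mult_mat[of _ n n _ n _ n])
  also have "\<dots> = Q' * (c \<cdot>\<^sub>m 1\<^sub>m n) * Q"
    using 1(3) by simp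
  also have "\<dots> = c \<cdot>\<^sub>m (Q' * Q)"
    using 1(4-6) by (simp add: mult_smult_distrib[of _ n n _ n] mult_smult_assoc_mat[of _ n n _ n])
  finally show ?thesis
    using 1 by simp
qed

lemma map_eigenvalues_scalar:
  fixes n :: nat
  shows "map_eigenvalues \<gamma> (c \<cdot>\<^sub>m 1\<^sub>m n) = \<gamma> c \<cdot>\<^sub>m 1\<^sub>m n"
proof -
  have eq: "c \<cdot>\<^sub>m 1\<^sub>m n = mat_diag n (\<lambda>_. c)" for c :: complex
    by (intro eq_matI) (auto simp: mat_diag_def)
  have "(\<exists>Q Q' d. similar_mat_wit (c \<cdot>\<^sub>m 1\<^sub>m n) (mat_diag n d) Q Q' \<and> M = Q * mat_diag n (\<gamma> \<circ> d) * Q')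
          \<longleftrightarrow> M = \<gamma> c \<cdot>\<^sub>m 1\<^sub>m n" for M
  proof
    assume "M = \<gamma> c \<cdot>\<^sub>m 1\<^sub>m n"
    then show "\<exists>Q Q' d. similar_mat_wit (c \<cdot>\<^sub>m 1\<^sub>m n) (mat_diag n d) Q Q' \<and> M = Q * mat_diag n (\<gamma> \<circ> d) * Q'"
      by (intro exI[of _ "1\<^sub>m n"] exI[of _ "\<lambda>_. c"])
        (auto simp: eq o_def similar_mat_wit_def Let_def carrier_matD[OF mat_diag_dim]
          left_mult_one_mat[OF mat_diag_dim] right_mult_one_mat[OF mat_diag_dim])
  next
    assume "\<exists>Q Q' d. similar_mat_wit (c \<cdot>\<^sub>m 1\<^sub>m n) (mat_diag n d) Q Q' \<and> M = Q * mat_diag n (\<gamma> \<circ> d) * Q'"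
    then obtain Q Q' d where 1: "similar_mat_wit (c \<cdot>\<^sub>m 1\<^sub>m n) (mat_diag n d) Q Q'"
      and M: "M = Q * mat_diag n (\<gamma> \<circ> d) * Q'" by blast
    have "d i = c" if "i < n" for i
      using arg_cong[OF similar_scalar[OF 1], of "\<lambda>M. M $$ (i, i)"] that
      by (simp add: mat_diag_def)
    then have "mat_diag n (\<gamma> \<circ> d) = \<gamma> c \<cdot>\<^sub>m 1\<^sub>m n"
      by (intro eq_matI) (auto simp: mat_diag_def)
    with M 1 show "M = \<gamma> c \<cdot>\<^sub>m 1\<^sub>m n"
      by (auto simp: similar_mat_wit_def Let_def mult_smult_distrib[of _ n n _ n]
          mult_smult_assoc_mat[of _ n n _ n])
  qed
  then show ?thesis
    by (simp add: map_eigenvalues_def Let_def)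
qed

lemma dunford_scaled_block:
  assumes "c \<noteq> 0"
  shows "dunford (scaled_block c) S U \<longleftrightarrow> S = c \<cdot>\<^sub>m 1\<^sub>m 2 \<and> U = scaled_block 1"
proof
  assume "S = c \<cdot>\<^sub>m 1\<^sub>m 2 \<and> U = scaled_block 1"
  then have S: "S = c \<cdot>\<^sub>m 1\<^sub>m 2" and U: "U = scaled_block 1" by auto
  have eq: "c \<cdot>\<^sub>m 1\<^sub>m 2 = mat_diag 2 (\<lambda>_. c)"
    by (intro eq_matI) (auto simp: mat_diag_def)
  have U': "U \<in> carrier_mat 2 2" by (simp add: U scaled_block_def)
  have "similar_mat S (mat_diag 2 (\<lambda>_. c))"
    unfolding S eq by (rule similar_mat_refl[of _ 2]) simp
  moreover have "S * U = c \<cdot>\<^sub>m U" "U * S = c \<cdot>\<^sub>m U"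
    using U' by (auto simp: S mult_smult_distrib[of _ 2 2 _ 2] mult_smult_assoc_mat[of _ 2 2 _ 2])
  moreover have "scaled_block c = c \<cdot>\<^sub>m U"
    by (intro eq_matI) (auto simp: U scaled_block_def)
  moreover have "(U - 1\<^sub>m 2) ^\<^sub>m 2 = 0\<^sub>m 2 2"
    by (intro eq_matI)
      (auto simp: U scaled_block_def numeral_2_eq_2 less_Suc_eq scalar_prod_def)
  ultimately show "dunford (scaled_block c) S U"
    using U' by (auto simp: dunford_def Let_def S)
next
  assume "dunford (scaled_block c) S U"
  then obtain d k where S: "S \<in> carrier_mat 2 2" and U: "U \<in> carrier_mat 2 2"
    and A: "scaled_block c = S * U" "S * U = U * S" and sim: "similar_mat S (mat_diag 2 d)"
    and nil: "(U - 1\<^sub>m 2) ^\<^sub>m k = 0\<^sub>m 2 2"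
    by (auto simp: dunford_def Let_def scaled_block_def)
  have "S * scaled_block c = scaled_block c * S"
    using S U by (simp add: A(1)) (metis A(2) assoc_mult_mat)
  from commute_scaled_block[OF S this assms]
  have S': "S $$ (1, 0) = 0" "S $$ (1, 1) = S $$ (0, 0)" .
  have "U * scaled_block c = scaled_block c * U"
    using S U by (simp add: A(1)) (metis A(2) assoc_mult_mat)
  from commute_scaled_block[OF U this assms]
  have U': "U $$ (1, 0) = 0" "U $$ (1, 1) = U $$ (0, 0)" .
  have "((U - 1\<^sub>m 2) ^\<^sub>m k) $$ (0, 0) = (U $$ (0, 0) - 1) ^ k"
    using U U' by (subst upper_pow_00) auto
  with nil have U00: "U $$ (0, 0) = 1"
    by simp
  have "scaled_block c $$ (i, j) = S $$ (i, 0) * U $$ (0, j) + S $$ (i, 1) * U $$ (1, j)"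
    if "i < 2" "j < 2" for i j
    using that S U by (simp add: A(1) mult_mat_2 del: index_mult_mat(1))
  from this[of 0 0] this[of 0 1] have c: "S $$ (0, 0) = c" "c = c * U $$ (0, 1) + S $$ (0, 1)"
    using U00 U' by (auto simp: scaled_block_def)
  define N where "N = S - c \<cdot>\<^sub>m 1\<^sub>m 2"
  have N: "N \<in> carrier_mat 2 2" by (simp add: N_def minus_carrier_mat)
  from sim obtain Q Q' where Q: "Q * Q' = 1\<^sub>m 2" "Q' * Q = 1\<^sub>m 2" "S = Q * mat_diag 2 d * Q'"
    "Q \<in> carrier_mat 2 2" "Q' \<in> carrier_mat 2 2"
    using S by (auto simp: similar_mat_def similar_mat_wit_def Let_def)
  define E where "E = mat_diag 2 (\<lambda>i. d i - c)"
  have E: "E \<in> carrier_mat 2 2" by (simp add: E_def)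
  have eqE: "E = mat_diag 2 d - c \<cdot>\<^sub>m 1\<^sub>m 2"
    by (intro eq_matI) (auto simp: E_def mat_diag_def)
  have "Q * E * Q' = N"
    using Q by (simp add: eqE N_def mult_minus_distrib_mat[of _ 2 2 _ 2]
        minus_mult_distrib_mat[of _ 2 2 _ _ 2] mult_smult_distrib[of _ 2 2 _ 2]
        mult_smult_assoc_mat[of _ 2 2 _ 2])
  have EN: "E = Q' * N * Q"
  proof -
    have "E = Q' * Q * E * (Q' * Q)" using Q E by simp
    also have "\<dots> = Q' * (Q * E * Q') * Q"
      using Q(4,5) E by (simp add: assoc_mult_mat[of _ 2 2 _ 2 _ 2])
    finally show ?thesis using \<open>Q * E * Q' = N\<close> by simp
  qed
  have NN: "N * N = 0\<^sub>m 2 2"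
  proof (intro eq_matI)
    fix i j assume "i < dim_row (0\<^sub>m 2 2)" "j < dim_col (0\<^sub>m 2 2)"
    then show "(N * N) $$ (i, j) = 0\<^sub>m 2 2 $$ (i, j)"
      using N S S' c(1) by (auto simp: mult_mat_2 lt_2_iff simp del: index_mult_mat(1))
        (auto simp: N_def)
  qed (use N in auto)
  have "E * E = Q' * N * (Q * Q') * N * Q"
    unfolding EN using Q(4,5) N by (simp add: assoc_mult_mat[of _ 2 2 _ 2 _ 2])
  also have "\<dots> = Q' * (N * N) * Q"
    using Q N by (simp add: assoc_mult_mat[of _ 2 2 _ 2 _ 2])
  finally have EE: "E * E = 0\<^sub>m 2 2" using Q by (simp add: NN)
  have "d i = c" if "i < 2" for i
  proof -
    have "E * E = mat_diag 2 (\<lambda>i. (d i - c) * (d i - c))" by (simp add: E_def)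
    then have "(E * E) $$ (i, i) = (d i - c) * (d i - c)" using that by (simp add: mat_diag_def)
    with EE that show ?thesis by simp
  qed
  then have "E = 0\<^sub>m 2 2"
    by (intro eq_matI) (auto simp: E_def mat_diag_def)
  then have "N = 0\<^sub>m 2 2" using \<open>Q * E * Q' = N\<close> Q by simp
  then have N0: "N $$ (i, j) = 0" if "i < 2" "j < 2" for i j
    using that by simp
  have S_eq: "S = c \<cdot>\<^sub>m 1\<^sub>m 2"
  proof (intro eq_matI)
    fix i j assume "i < dim_row (c \<cdot>\<^sub>m 1\<^sub>m 2)" "j < dim_col (c \<cdot>\<^sub>m 1\<^sub>m 2)"
    then show "S $$ (i, j) = (c \<cdot>\<^sub>m 1\<^sub>m 2) $$ (i, j)"
      using N0[of i j] S by (simp add: N_def)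
  qed (use S in auto)
  moreover have "U = scaled_block 1"
  proof (intro eq_matI)
    fix i j assume "i < dim_row (scaled_block 1)" "j < dim_col (scaled_block 1)"
    moreover have "U $$ (0, 1) = 1" using c(2) assms by (simp add: S_eq)
    ultimately show "U $$ (i, j) = scaled_block 1 $$ (i, j)"
      using U' U00 by (auto simp: scaled_block_def lt_2_iff)
  qed (use U in \<open>auto simp: scaled_block_def\<close>)
  ultimately show "S = c \<cdot>\<^sub>m 1\<^sub>m 2 \<and> U = scaled_block 1" by blast
qed

lemma unipotent_power_block: "unipotent_power (scaled_block 1) \<mu> $$ (0, 0) = 1"
  "unipotent_power (scaled_block 1) \<mu> $$ (0, 1) = \<mu>"
proof -
  define N :: "complex mat" where "N = scaled_block 1 - 1\<^sub>m 2"
  have N: "N \<in> carrier_mat 2 2" "N $$ (0, 0) = 0" "N $$ (1, 0) = 0" "N $$ (0, 1) = 1" "N $$ (1, 1) = 0"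
    by (auto simp: N_def scaled_block_def)
  have NN: "N ^\<^sub>m Suc (Suc k) = 0\<^sub>m 2 2" for k
  proof -
    have "N * N = 0\<^sub>m 2 2"
      using N by (intro eq_matI) (auto simp: mult_mat_2 lt_2_iff simp del: index_mult_mat(1))
    then show ?thesis
      using N pow_carrier_mat[OF N(1), of k] by (simp add: assoc_mult_mat[of _ 2 2 _ 2 _ 2])
  qed
  have "(\<Sum>k. (\<mu> gchoose k) * (N ^\<^sub>m k) $$ (i, j)) = (\<Sum>k\<in>{0,1}. (\<mu> gchoose k) * (N ^\<^sub>m k) $$ (i, j))"
    if "i < 2" "j < 2" for i j
  proof (rule suminf_finite)
    fix k :: nat assume "k \<notin> {0, 1}"
    then obtain k' where "k = Suc (Suc k')" by (cases k; cases "k - 1") auto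
    with that show "(\<mu> gchoose k) * (N ^\<^sub>m k) $$ (i, j) = 0" by (simp only: NN) simp
  qed auto
  then have "unipotent_power (scaled_block 1) \<mu> $$ (i, j) = 1\<^sub>m 2 $$ (i, j) + \<mu> * N $$ (i, j)"
    if "i < 2" "j < 2" for i j
    using that N(1) by (simp add: unipotent_power_def Let_def scaled_block_def flip: N_def)
      (simp add: N_def scaled_block_def)
  from this[of 0 0] this[of 0 1] N
  show "unipotent_power (scaled_block 1) \<mu> $$ (0, 0) = 1"
    "unipotent_power (scaled_block 1) \<mu> $$ (0, 1) = \<mu>" by auto
qed

lemma scaled_block_in_objects:
  assumes "c \<noteq> 0"
  shows "scaled_block c \<in> objects"
proof -
  define B where "B = mat 2 2 (\<lambda>(i, j). if j < i then 0 else if i = j then 1 / c else - 1 / c)"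
  have "scaled_block c * B = 1\<^sub>m 2" "B * scaled_block c = 1\<^sub>m 2"
    using assms by (auto intro!: eq_matI
        simp: B_def scaled_block_def scalar_prod_def numeral_2_eq_2 less_Suc_eq)
  then show ?thesis
    by (auto simp: objects_def invertible_mat_def inverts_mat_def scaled_block_def B_def
        intro!: exI[of _ B])
qed

lemma Zalg_aut_scaled_block:
  assumes "c \<noteq> 0"
  shows "Zalg_aut (\<gamma>, \<mu>) (scaled_block c) $$ (0, 0) = \<gamma> c"
    "Zalg_aut (\<gamma>, \<mu>) (scaled_block c) $$ (0, 1) = \<gamma> c * \<mu>"
proof -
  have "ss_part (scaled_block c) = c \<cdot>\<^sub>m 1\<^sub>m 2" "un_part (scaled_block c) = scaled_block 1"
    by (simp_all add: ss_part_def un_part_def dunford_scaled_block[OF assms])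
  then have *: "Zalg_aut (\<gamma>, \<mu>) (scaled_block c) = \<gamma> c \<cdot>\<^sub>m unipotent_power (scaled_block 1) \<mu>"
    using scaled_block_in_objects[OF assms]
    by (simp add: map_eigenvalues_scalar mult_smult_assoc_mat[of _ 2 2 _ 2] unipotent_power_def
        scaled_block_def Let_def)
  then show "Zalg_aut (\<gamma>, \<mu>) (scaled_block c) $$ (0, 0) = \<gamma> c"
    "Zalg_aut (\<gamma>, \<mu>) (scaled_block c) $$ (0, 1) = \<gamma> c * \<mu>"
    using unipotent_power_block[of \<mu>]
    by (simp_all add: unipotent_power_def Let_def scaled_block_def)
qed

lemma inj_on_Zalg_aut: "inj_on Zalg_aut Zalg"
proof (rule inj_onI, clarify)
  fix \<gamma> \<mu> \<gamma>' \<mu>'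
  assume in_Zalg: "(\<gamma>, \<mu>) \<in> Zalg" "(\<gamma>', \<mu>') \<in> Zalg"
    and eq: "Zalg_aut (\<gamma>, \<mu>) = Zalg_aut (\<gamma>', \<mu>')"
  have g: "\<gamma> c = \<gamma>' c" if "c \<noteq> 0" for c
    using Zalg_aut_scaled_block(1)[OF that, of \<gamma> \<mu>] Zalg_aut_scaled_block(1)[OF that, of \<gamma>' \<mu>'] eq
    by (simp del: Zalg_aut.simps)
  then have "\<gamma> = \<gamma>'"
    using in_Zalg by (intro extensionalityI[of _ "carrier Cstar"]) (auto simp: Zalg_def Cstar_def)
  moreover have "\<gamma> 1 \<noteq> 0"
    using in_Zalg by (auto simp: Zalg_def Cstar_def hom_def)
  then have "\<mu> = \<mu>'"
    using Zalg_aut_scaled_block(2)[of 1 \<gamma> \<mu>] Zalg_aut_scaled_block(2)[of 1 \<gamma>' \<mu>'] eq g[of 1]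
    by (simp del: Zalg_aut.simps)
  ultimately show "\<gamma> = \<gamma>' \<and> \<mu> = \<mu>'" by simp
qed

end

theory Submission
  imports Defs "Jordan_Normal_Form.Jordan_Normal_Form_Existence"
begin

text \<open>Two facts combine.

  First, the tensor automorphisms of the forgetful functor on representations of the integers are
  exactly those given by the pairs \<open>(\<gamma>, \<mu>)\<close> (\<open>Aut_R_eq\<close>). That a pair defines an automorphism
  (\<open>Zalg_aut_in_Aut_R\<close>) rests on two properties of the Dunford decomposition \<open>A = S U\<close>: a matrix
  intertwining \<open>A\<close> and \<open>B\<close> intertwines the semisimple and the unipotent parts separately
  (\<open>dunford_natural_ss\<close>, \<open>dunford_natural_un\<close>, which also give uniqueness), and the decomposition of a
  Kronecker product is formed factor by factor (\<open>dunford_kronecker\<close>). Complex powers of unipotent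
  matrices are handled by the observation that their entries are polynomials in the exponent, so that
  identities only have to be verified for natural exponents (\<open>unipotent_power_kronecker\<close>).
  Conversely, an automorphism is determined by its values on the objects \<open>(\<complex>, c)\<close> and on the unipotent
  Jordan block of size \<open>2\<close> (\<open>Aut_R_eqI\<close>), because these generate all Jordan blocks, hence all
  objects, under tensor products, quotients and direct sums.

  Second, if \<open>F = \<Sum> F\<^sub>k z ^ k\<close> is a morphism from \<open>A\<close> to \<open>B\<close>, then comparing coefficients in
  \<open>F (q z) A = B F (z)\<close> shows that \<open>F\<^sub>k\<close> is a constant morphism from \<open>q ^ k A\<close> to \<open>B\<close>. Only finitely
  many \<open>F\<^sub>k\<close> are nonzero, as \<open>q ^ k\<close> must be a quotient of eigenvalues (\<open>hom_P0_finite\<close>). An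
  automorphism \<open>\<phi>\<close> given by \<open>(\<gamma>, \<mu>)\<close> satisfies \<open>\<phi> (q ^ k A) = (\<gamma> q) ^ k \<phi> (A)\<close>, so that evaluation
  of \<open>F\<close> at \<open>z0\<close> on one side and at \<open>z1 = \<gamma> q z0\<close> on the other is compatible with \<open>\<phi>\<close>
  (\<open>Zalg_aut_in_Iso_P0\<close>). The morphism \<open>z\<close> from \<open>(\<complex>, 1)\<close> to \<open>(\<complex>, q)\<close> shows that the condition
  \<open>\<gamma> q z0 = z1\<close> is necessary (\<open>Zalg_aut_in_Iso_P0D\<close>).\<close>

section \<open>Matrix algebra and Kronecker products\<close>

lemma mat_mult_assoc:
  assumes "dim_col A = dim_row B" "dim_col B = dim_row C"
  shows "A * B * C = A * (B * C)"
  using assms by (intro assoc_mult_mat[of _ "dim_row A" "dim_row B" _ "dim_row C" _ "dim_col C"]) auto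

lemma mat_distrib:
  assumes "dim_row B = dim_row C" "dim_col B = dim_col C"
  shows "dim_col A = dim_row B \<Longrightarrow> A * (B + C) = A * B + A * C"
    "dim_col B = dim_row A \<Longrightarrow> (B + C) * A = B * A + C * A"
  using assms by (auto intro!: mult_add_distrib_mat[of _ "dim_row A" "dim_row C" _ "dim_col C"]
      add_mult_distrib_mat[of _ "dim_row C" "dim_col C" _ _ "dim_col A"])

lemma mat_distrib_minus:
  fixes A B C :: "'a :: ring mat"
  assumes "dim_row B = dim_row C" "dim_col B = dim_col C"
  shows "dim_col A = dim_row B \<Longrightarrow> A * (B - C) = A * B - A * C"
    "dim_col B = dim_row A \<Longrightarrow> (B - C) * A = B * A - C * A"
  using assms by (auto intro!: mult_minus_distrib_mat[of _ "dim_row A" "dim_row C" _ "dim_col C"]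
      minus_mult_distrib_mat[of _ "dim_row C" "dim_col C" _ _ "dim_col A"])

lemma pow_mat_mult_commute:
  assumes "A \<in> carrier_mat n n" "B \<in> carrier_mat m m" "X \<in> carrier_mat n m" "A * X = X * B"
  shows "A ^\<^sub>m k * X = X * B ^\<^sub>m k"
proof (induction k)
  case 0
  then show ?case using assms by simp
next
  case (Suc k)
  note [simp] = carrier_matD[OF assms(1)] carrier_matD[OF assms(2)] carrier_matD[OF assms(3)]
  have "A ^\<^sub>m Suc k * X = A ^\<^sub>m k * (X * B)"
    by (simp add: mat_mult_assoc assms(4))
  also have "\<dots> = A ^\<^sub>m k * X * B"
    by (simp add: mat_mult_assoc)
  also have "\<dots> = X * B ^\<^sub>m Suc k"
    by (subst Suc) (simp add: mat_mult_assoc)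
  finally show ?case .
qed

lemma pow_mat_Suc_left:
  assumes "A \<in> carrier_mat n n"
  shows "A ^\<^sub>m Suc k = A * A ^\<^sub>m k"
  using pow_mat_mult_commute[OF assms assms assms refl, of k] by simp

lemma pow_mat_mult_distrib:
  assumes A: "A \<in> carrier_mat n n" and B: "B \<in> carrier_mat n n" and AB: "A * B = B * A"
  shows "(A * B) ^\<^sub>m k = A ^\<^sub>m k * B ^\<^sub>m k"
proof (induction k)
  case 0
  then show ?case using A B by simp
next
  case (Suc k)
  note [simp] = carrier_matD[OF A] carrier_matD[OF B]
  have "(A * B) ^\<^sub>m Suc k = A ^\<^sub>m k * ((B ^\<^sub>m k * A) * B)"
    by (simp add: mat_mult_assoc Suc)
  also have "B ^\<^sub>m k * A = A * B ^\<^sub>m k"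
    by (rule pow_mat_mult_commute[OF B B A]) (simp add: AB)
  finally show ?case
    by (simp add: mat_mult_assoc)
qed

lemma pow_mat_zero_mono:
  assumes "A \<in> carrier_mat n n" "A ^\<^sub>m k = 0\<^sub>m n n" "k \<le> l"
  shows "A ^\<^sub>m l = 0\<^sub>m n n"
  using assms(3)
proof (induction l rule: dec_induct)
  case base
  then show ?case using assms by simp
next
  case (step l)
  then show ?case using assms(1) by simp
qed

text \<open>Expanding the power of the sum, every term contains at least \<open>k\<close> factors \<open>A\<close> or \<open>k\<close> factors
  \<open>B\<close>; the induction keeps track of the factors already split off.\<close>

lemma nilpotent_add:
  fixes A B :: "'a :: ring_1 mat"
  assumes A: "A \<in> carrier_mat n n" and B: "B \<in> carrier_mat n n" and AB: "A * B = B * A"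
    and "A ^\<^sub>m k = 0\<^sub>m n n" "B ^\<^sub>m k = 0\<^sub>m n n"
  shows "(A + B) ^\<^sub>m (k + k) = 0\<^sub>m n n"
proof -
  note [simp] = carrier_matD[OF A] carrier_matD[OF B]
  have "A ^\<^sub>m i * (B ^\<^sub>m j * (A + B) ^\<^sub>m s) = 0\<^sub>m n n" if "k + k \<le> i + j + s" for i j s
    using that
  proof (induction s arbitrary: i j)
    case 0
    then have "k \<le> i \<or> k \<le> j" by auto
    then show ?case
      using pow_mat_zero_mono[OF A assms(4), of i] pow_mat_zero_mono[OF B assms(5), of j] A B by auto
  next
    case (Suc s)
    let ?C = "(A + B) ^\<^sub>m s"
    have C: "?C \<in> carrier_mat n n" using A B by simp
    note [simp] = carrier_matD[OF C]
    have "A ^\<^sub>m i * (B ^\<^sub>m j * (A + B) ^\<^sub>m Suc s)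
        = A ^\<^sub>m i * (B ^\<^sub>m j * (A * ?C + B * ?C))"
      using A B by (simp add: pow_mat_Suc_left[of _ n] mat_distrib del: pow_mat.simps)
    also have "\<dots> = A ^\<^sub>m i * (B ^\<^sub>m j * A * ?C) + A ^\<^sub>m i * (B ^\<^sub>m j * B * ?C)"
      using A B C by (simp add: mat_distrib mat_mult_assoc)
    also have "B ^\<^sub>m j * A = A * B ^\<^sub>m j"
      by (rule pow_mat_mult_commute[OF B B A]) (simp add: AB)
    also have "A ^\<^sub>m i * (A * B ^\<^sub>m j * ?C) + A ^\<^sub>m i * (B ^\<^sub>m j * B * ?C)
       = A ^\<^sub>m Suc i * (B ^\<^sub>m j * ?C) + A ^\<^sub>m i * (B ^\<^sub>m Suc j * ?C)"
      using A B C by (simp add: mat_mult_assoc)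
    also have "\<dots> = 0\<^sub>m n n"
      using Suc.IH[of "Suc i" j] Suc.IH[of i "Suc j"] Suc.prems by simp
    finally show ?case .
  qed
  from this[of 0 0 "k + k"] show ?thesis
    using A B by simp
qed

lemma index_mult_mat_sum:
  assumes "i < dim_row A" "j < dim_col B" "dim_col A = dim_row B"
  shows "(A * B) $$ (i, j) = (\<Sum>l<dim_row B. A $$ (i, l) * B $$ (l, j))"
  using assms by (simp add: scalar_prod_def atLeast0LessThan)

lemma dim_kronecker [simp]:
  "dim_row (kronecker A B) = dim_row A * dim_row B"
  "dim_col (kronecker A B) = dim_col A * dim_col B"
  by (simp_all add: kronecker_def)

lemma kronecker_carrier:
  assumes "A \<in> carrier_mat n n'" "B \<in> carrier_mat m m'"
  shows "kronecker A B \<in> carrier_mat (n * m) (n' * m')"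
  using assms by (auto intro!: carrier_matI)

lemma div_mod_less:
  assumes "i < n * (m :: nat)"
  shows "i div m < n" "i mod m < m"
  using assms by (auto simp: less_mult_imp_div_less) (metis mult_0_right neq0_conv not_less0 mod_less_divisor)

lemma index_kronecker [simp]:
  assumes "i < dim_row A * dim_row B" "j < dim_col A * dim_col B"
  shows "kronecker A B $$ (i, j)
    = A $$ (i div dim_row B, j div dim_col B) * B $$ (i mod dim_row B, j mod dim_col B)"
  using assms by (simp add: kronecker_def)

lemma sum_div_mod:
  fixes f :: "nat \<Rightarrow> nat \<Rightarrow> 'a :: comm_monoid_add"
  shows "(\<Sum>l<n * m. f (l div m) (l mod m)) = (\<Sum>a<n. \<Sum>b<m. f a b)"
proof -
  have "(\<Sum>a<n. \<Sum>b<m. f a b) = (\<Sum>(a, b)\<in>{..<n} \<times> {..<m}. f a b)"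
    by (simp add: sum.cartesian_product)
  also have "\<dots> = (\<Sum>l<n * m. f (l div m) (l mod m))"
  proof (rule sum.reindex_bij_witness[of _ "\<lambda>l. (l div m, l mod m)" "\<lambda>(a, b). a * m + b"])
    fix x assume "x \<in> {..<n} \<times> {..<m}"
    then obtain a b where x: "x = (a, b)" "a < n" "b < m" by auto
    have "a * m + b < a * m + m" using x by simp
    also have "\<dots> = Suc a * m" by simp
    also have "\<dots> \<le> n * m" using x by (intro mult_right_mono) auto
    finally show "(case x of (a, b) \<Rightarrow> a * m + b) \<in> {..<n * m}" using x by simp
  qed (auto simp: div_mod_less)
  finally show ?thesis ..
qed

text \<open>The mixed product property, that is functoriality of the tensor product.\<close>

lemma kronecker_mult:
  fixes A B C D :: "'a :: comm_semiring_0 mat"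
  assumes "dim_col A = dim_row C" "dim_col B = dim_row D"
  shows "kronecker A B * kronecker C D = kronecker (A * C) (B * D)"
proof (intro eq_matI)
  fix i j assume ij: "i < dim_row (kronecker (A * C) (B * D))" "j < dim_col (kronecker (A * C) (B * D))"
  then have *: "i div dim_row B < dim_row A" "i mod dim_row B < dim_row B"
    "j div dim_col D < dim_col C" "j mod dim_col D < dim_col D"
    by (auto simp: div_mod_less)
  have "(kronecker A B * kronecker C D) $$ (i, j)
     = (\<Sum>l<dim_row C * dim_row D. kronecker A B $$ (i, l) * kronecker C D $$ (l, j))"
    using ij assms by (subst index_mult_mat_sum) auto
  also have "\<dots> = (\<Sum>l<dim_row C * dim_row D.
      (A $$ (i div dim_row B, l div dim_row D) * C $$ (l div dim_row D, j div dim_col D)) *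
      (B $$ (i mod dim_row B, l mod dim_row D) * D $$ (l mod dim_row D, j mod dim_col D)))"
    using ij assms by (intro sum.cong) (auto simp: mult_ac)
  also have "\<dots> = (\<Sum>a<dim_row C. \<Sum>b<dim_row D.
      (A $$ (i div dim_row B, a) * C $$ (a, j div dim_col D)) *
      (B $$ (i mod dim_row B, b) * D $$ (b, j mod dim_col D)))"
    by (rule sum_div_mod)
  also have "\<dots> = (\<Sum>a<dim_row C. A $$ (i div dim_row B, a) * C $$ (a, j div dim_col D)) *
      (\<Sum>b<dim_row D. B $$ (i mod dim_row B, b) * D $$ (b, j mod dim_col D))"
    by (simp add: sum_product)
  also have "\<dots> = kronecker (A * C) (B * D) $$ (i, j)"
    using ij assms * by (simp add: index_mult_mat_sum del: index_mult_mat(1))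
  finally show "(kronecker A B * kronecker C D) $$ (i, j) = kronecker (A * C) (B * D) $$ (i, j)" .
qed auto

lemma kronecker_mat_diag:
  fixes c d :: "nat \<Rightarrow> 'a :: mult_zero"
  shows "kronecker (mat_diag n c) (mat_diag m d) = mat_diag (n * m) (\<lambda>i. c (i div m) * d (i mod m))"
proof (intro eq_matI)
  fix i j assume "i < dim_row (mat_diag (n * m) (\<lambda>i. c (i div m) * d (i mod m)))"
    "j < dim_col (mat_diag (n * m) (\<lambda>i. c (i div m) * d (i mod m)))"
  then have "i < n * m" "j < n * m" by (auto simp: mat_diag_def)
  moreover have "i = j" if "i div m = j div m" "i mod m = j mod m"
    using that by (metis div_mult_mod_eq)
  ultimately show "kronecker (mat_diag n c) (mat_diag m d) $$ (i, j)
      = mat_diag (n * m) (\<lambda>i. c (i div m) * d (i mod m)) $$ (i, j)"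
    by (auto simp: mat_diag_def div_mod_less)
qed (auto simp: mat_diag_def)

lemma kronecker_one:
  "kronecker (1\<^sub>m n) (1\<^sub>m m) = (1\<^sub>m (n * m) :: 'a :: semiring_1 mat)"
  using kronecker_mat_diag[of n "\<lambda>_. 1 :: 'a" m "\<lambda>_. 1"] by simp

lemma kronecker_add_left:
  fixes A B C :: "'a :: semiring_0 mat"
  assumes "A \<in> carrier_mat n m" "B \<in> carrier_mat n m"
  shows "kronecker (A + B) C = kronecker A C + kronecker B C"
  using assms by (intro eq_matI) (auto simp: div_mod_less distrib_right)

lemma kronecker_add_right:
  fixes A B C :: "'a :: semiring_0 mat"
  assumes "A \<in> carrier_mat n m" "B \<in> carrier_mat n m"
  shows "kronecker C (A + B) = kronecker C A + kronecker C B"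
  using assms by (intro eq_matI) (auto simp: div_mod_less distrib_left)

lemma kronecker_zero:
  "kronecker (0\<^sub>m n m) C = (0\<^sub>m (n * dim_row C) (m * dim_col C) :: 'a :: semiring_0 mat)"
  "kronecker C (0\<^sub>m n m) = (0\<^sub>m (dim_row C * n) (dim_col C * m) :: 'a :: semiring_0 mat)"
  by (intro eq_matI; auto simp: div_mod_less)+

lemma kronecker_scalar:
  "kronecker (c \<cdot>\<^sub>m 1\<^sub>m 1) A = c \<cdot>\<^sub>m (A :: 'a :: semiring_1 mat)"
  by (intro eq_matI) auto

lemma pow_mat_kronecker:
  fixes A B :: "'a :: comm_semiring_1 mat"
  assumes "A \<in> carrier_mat n n" "B \<in> carrier_mat m m"
  shows "kronecker A B ^\<^sub>m k = kronecker (A ^\<^sub>m k) (B ^\<^sub>m k)"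
  using assms by (induction k) (auto simp: kronecker_mult kronecker_one)

section \<open>Functional calculus on diagonalisable matrices\<close>

lemma similar_mat_witD_carrier:
  assumes "similar_mat_wit S D Q Q'" "D \<in> carrier_mat n n"
  shows "S \<in> carrier_mat n n" "Q \<in> carrier_mat n n" "Q' \<in> carrier_mat n n"
    "Q * Q' = 1\<^sub>m n" "Q' * Q = 1\<^sub>m n" "S = Q * D * Q'"
proof -
  have "dim_row S = n"
    using similar_mat_witD(5)[OF refl assms(1)] assms(2) by (metis carrier_matD(1))
  from similar_mat_witD[OF this[symmetric] assms(1)]
  show "S \<in> carrier_mat n n" "Q \<in> carrier_mat n n" "Q' \<in> carrier_mat n n"
    "Q * Q' = 1\<^sub>m n" "Q' * Q = 1\<^sub>m n" "S = Q * D * Q'" by blast+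
qed

lemma mult_cancel_inverse:
  fixes X :: "'a :: semiring_1 mat"
  assumes "Q' * Q = 1\<^sub>m n" "Q' \<in> carrier_mat n n" "Q \<in> carrier_mat n n" "dim_row X = n"
  shows "Q' * (Q * X) = X"
proof -
  have "Q' * (Q * X) = Q' * Q * X"
    using assms(2-) by (subst mat_mult_assoc) auto
  then show ?thesis using assms by (simp add: left_mult_one_mat')
qed

text \<open>Written in eigenbases, intertwining two diagonal matrices is a condition on each entry.\<close>

lemma intertwine_diagonalisable_iff:
  assumes S: "similar_mat_wit S (mat_diag n c) Q Q'"
    and S': "similar_mat_wit S' (mat_diag m d) P P'"
    and F: "F \<in> carrier_mat m n"
  shows "F * S = S' * F \<longleftrightarrow>
    (\<forall>i<m. \<forall>j<n. (P' * F * Q) $$ (i, j) * c j = d i * (P' * F * Q) $$ (i, j))"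
proof -
  note Q = similar_mat_witD_carrier[OF S mat_diag_dim]
  note P = similar_mat_witD_carrier[OF S' mat_diag_dim]
  note [simp] = carrier_matD[OF F] carrier_matD[OF mat_diag_dim]
    carrier_matD[OF Q(2)] carrier_matD[OF Q(3)] carrier_matD[OF P(2)] carrier_matD[OF P(3)]
  note cancel = mult_cancel_inverse[OF Q(4,2,3)] mult_cancel_inverse[OF Q(5,3,2)]
    mult_cancel_inverse[OF P(4,2,3)] mult_cancel_inverse[OF P(5,3,2)]
  define G where "G = P' * F * Q"
  have G: "G \<in> carrier_mat m n" by (simp add: G_def carrier_matI)
  have "F * S = S' * F \<longleftrightarrow> P' * (F * S) * Q = P' * (S' * F) * Q"
  proof
    assume "P' * (F * S) * Q = P' * (S' * F) * Q"
    then have "P * (P' * (F * S) * Q) * Q' = P * (P' * (S' * F) * Q) * Q'" by simp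
    then show "F * S = S' * F"
      using Q(1,4) P(1) F by (simp add: mat_mult_assoc cancel carrier_matD[OF Q(1)] carrier_matD[OF P(1)])
  qed simp
  also have "P' * (F * S) * Q = G * mat_diag n c"
    using Q(5) by (simp add: Q(6) G_def mat_mult_assoc right_mult_one_mat[OF mat_diag_dim])
  also have "P' * (S' * F) * Q = mat_diag m d * G"
    by (simp add: P(6) G_def mat_mult_assoc cancel)
  also have "G * mat_diag n c = mat_diag m d * G \<longleftrightarrow> (\<forall>i<m. \<forall>j<n. G $$ (i, j) * c j = d i * G $$ (i, j))"
    using G by (auto simp: mat_diag_mult_right[OF G] mat_diag_mult_left[OF G] mat_eq_iff)
  finally show ?thesis by (simp only: G_def)
qed

lemma similar_mat_wit_conj:
  assumes "similar_mat_wit S (mat_diag n c) Q Q'"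
  shows "similar_mat_wit (Q * mat_diag n d * Q') (mat_diag n d) Q Q'"
  using similar_mat_witD_carrier(2-5)[OF assms mat_diag_dim]
  by (simp add: similar_mat_wit_def Let_def mult_carrier_mat[of _ n n])

text \<open>Two diagonalisable matrices with an intertwiner \<open>F\<close>: in eigenbases, \<open>F\<close> has nonzero entries
  only between equal eigenvalues, so that it stays an intertwiner if all eigenvalues are mapped by
  \<open>\<gamma>\<close>. The case \<open>F = 1\<close> shows that the result does not depend on the eigenbasis.\<close>

lemma intertwine_conj:
  fixes c d :: "nat \<Rightarrow> complex"
  assumes S: "similar_mat_wit S (mat_diag n c) Q Q'"
    and S': "similar_mat_wit S' (mat_diag m d) P P'"
    and F: "F \<in> carrier_mat m n" "F * S = S' * F"
  shows "F * (Q * mat_diag n (\<gamma> \<circ> c) * Q') = (P * mat_diag m (\<gamma> \<circ> d) * P') * F"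
proof -
  have "(P' * F * Q) $$ (i, j) * (\<gamma> \<circ> c) j = (\<gamma> \<circ> d) i * (P' * F * Q) $$ (i, j)"
    if "i < m" "j < n" for i j
  proof (cases "(P' * F * Q) $$ (i, j) = 0")
    case False
    have "(P' * F * Q) $$ (i, j) * c j = d i * (P' * F * Q) $$ (i, j)"
      using F(2) that unfolding intertwine_diagonalisable_iff[OF S S' F(1)] by blast
    with False have "c j = d i" by (simp add: mult.commute del: index_mult_mat(1))
    then show ?thesis by (simp add: mult.commute del: index_mult_mat(1))
  qed (simp del: index_mult_mat(1))
  then show ?thesis
    unfolding intertwine_diagonalisable_iff[OF similar_mat_wit_conj[OF S] similar_mat_wit_conj[OF S'] F(1)]
    by blast
qed

lemma map_eigenvalues_eq:
  assumes "similar_mat_wit S (mat_diag n c) Q Q'"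
  shows "map_eigenvalues \<gamma> S = Q * mat_diag n (\<gamma> \<circ> c) * Q'"
proof -
  have n: "dim_row S = n"
    using similar_mat_witD_carrier(1)[OF assms mat_diag_dim] by simp
  show ?thesis
    unfolding map_eigenvalues_def Let_def n
  proof (rule the_equality)
    fix M assume "\<exists>P P' d. similar_mat_wit S (mat_diag n d) P P' \<and> M = P * mat_diag n (\<gamma> \<circ> d) * P'"
    then obtain P P' d where P: "similar_mat_wit S (mat_diag n d) P P'" "M = P * mat_diag n (\<gamma> \<circ> d) * P'"
      by blast
    note 1 = similar_mat_witD_carrier[OF P(1) mat_diag_dim]
    note 2 = similar_mat_witD_carrier[OF assms mat_diag_dim]
    have "1\<^sub>m n * (P * mat_diag n (\<gamma> \<circ> d) * P') = (Q * mat_diag n (\<gamma> \<circ> c) * Q') * 1\<^sub>m n"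
      by (rule intertwine_conj[OF P(1) assms]) (use 1(1) in auto)
    then show "M = Q * mat_diag n (\<gamma> \<circ> c) * Q'"
      using 1(2,3) 2(2,3) by (simp add: P(2) carrier_matD[OF mat_diag_dim])
  qed (use assms in blast)
qed

lemma map_eigenvalues_natural:
  assumes S: "S \<in> carrier_mat n n" "similar_mat S (mat_diag n c)"
    and S': "S' \<in> carrier_mat m m" "similar_mat S' (mat_diag m d)"
    and F: "F \<in> carrier_mat m n" "F * S = S' * F"
  shows "F * map_eigenvalues \<gamma> S = map_eigenvalues \<gamma> S' * F"
proof -
  from S S' obtain Q Q' P P' where
    *: "similar_mat_wit S (mat_diag n c) Q Q'" "similar_mat_wit S' (mat_diag m d) P P'"
    by (auto simp: similar_mat_def)
  show ?thesis
    using intertwine_conj[OF * F] by (simp add: map_eigenvalues_eq[OF *(1)] map_eigenvalues_eq[OF *(2)])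
qed

lemma similar_mat_wit_kronecker:
  fixes A B :: "'a :: comm_semiring_1 mat"
  assumes A: "similar_mat_wit A D Q Q'" "D \<in> carrier_mat n n"
    and B: "similar_mat_wit B E P P'" "E \<in> carrier_mat m m"
  shows "similar_mat_wit (kronecker A B) (kronecker D E) (kronecker Q P) (kronecker Q' P')"
proof -
  note 1 = similar_mat_witD_carrier[OF A]
  note 2 = similar_mat_witD_carrier[OF B]
  note [simp] = carrier_matD[OF A(2)] carrier_matD[OF B(2)] carrier_matD[OF 1(1)] carrier_matD[OF 2(1)]
    carrier_matD[OF 1(2)] carrier_matD[OF 2(2)] carrier_matD[OF 1(3)] carrier_matD[OF 2(3)]
  show ?thesis
  proof (rule similar_mat_witI[of _ _ "n * m"])
    show "kronecker Q P * kronecker Q' P' = 1\<^sub>m (n * m)" "kronecker Q' P' * kronecker Q P = 1\<^sub>m (n * m)"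
      using 1(4,5) 2(4,5) by (simp_all add: kronecker_mult kronecker_one)
    show "kronecker A B = kronecker Q P * kronecker D E * kronecker Q' P'"
      by (simp add: kronecker_mult 1(6) 2(6))
  qed (auto intro!: carrier_matI)
qed

lemma mat_diag_cong:
  assumes "\<And>i. i < n \<Longrightarrow> c i = d i"
  shows "mat_diag n c = mat_diag n d"
  using assms by (intro eq_matI) (auto simp: mat_diag_def)

lemma map_eigenvalues_kronecker:
  assumes S: "similar_mat_wit S (mat_diag n c) Q Q'"
    and T: "similar_mat_wit T (mat_diag m d) P P'"
    and mult: "\<And>i j. i < n \<Longrightarrow> j < m \<Longrightarrow> \<gamma> (c i * d j) = \<gamma> (c i) * \<gamma> (d j)"
  shows "map_eigenvalues \<gamma> (kronecker S T) = kronecker (map_eigenvalues \<gamma> S) (map_eigenvalues \<gamma> T)"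
proof -
  note 1 = similar_mat_witD_carrier[OF S mat_diag_dim]
  note 2 = similar_mat_witD_carrier[OF T mat_diag_dim]
  note [simp] = carrier_matD[OF mat_diag_dim]
    carrier_matD[OF 1(2)] carrier_matD[OF 2(2)] carrier_matD[OF 1(3)] carrier_matD[OF 2(3)]
  let ?e = "\<lambda>i. c (i div m) * d (i mod m)"
  have "similar_mat_wit (kronecker S T) (mat_diag (n * m) ?e) (kronecker Q P) (kronecker Q' P')"
    using similar_mat_wit_kronecker[OF S mat_diag_dim T mat_diag_dim] by (simp only: kronecker_mat_diag)
  from map_eigenvalues_eq[OF this] have
    "map_eigenvalues \<gamma> (kronecker S T) = kronecker Q P * mat_diag (n * m) (\<gamma> \<circ> ?e) * kronecker Q' P'" .
  also have "mat_diag (n * m) (\<gamma> \<circ> ?e) = kronecker (mat_diag n (\<gamma> \<circ> c)) (mat_diag m (\<gamma> \<circ> d))"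
    unfolding kronecker_mat_diag by (rule mat_diag_cong) (simp add: mult div_mod_less)
  also have "kronecker Q P * \<dots> * kronecker Q' P' = kronecker (Q * mat_diag n (\<gamma> \<circ> c) * Q') (P * mat_diag m (\<gamma> \<circ> d) * P')"
    by (simp add: kronecker_mult)
  finally show ?thesis
    by (simp add: map_eigenvalues_eq[OF S] map_eigenvalues_eq[OF T])
qed

section \<open>The multiplicative Dunford decomposition\<close>

lemma dunfordE:
  assumes "dunford A S U" "A \<in> carrier_mat n n"
  obtains c Q Q' k where "S \<in> carrier_mat n n" "U \<in> carrier_mat n n" "A = S * U" "S * U = U * S"
    "similar_mat_wit S (mat_diag n c) Q Q'" "(U - 1\<^sub>m n) ^\<^sub>m k = 0\<^sub>m n n"
  using assms unfolding dunford_def Let_def similar_mat_def by auto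

lemma dunfordI:
  assumes "S \<in> carrier_mat n n" "U \<in> carrier_mat n n" "A = S * U" "S * U = U * S"
    "similar_mat_wit S (mat_diag n c) Q Q'" "(U - 1\<^sub>m n) ^\<^sub>m k = 0\<^sub>m n n"
  shows "dunford A S U"
  using assms unfolding dunford_def Let_def similar_mat_def by auto

text \<open>The map \<open>D X = X S - S' X\<close> is diagonalisable. On \<open>F\<close> it agrees with the nilpotent map
  \<open>X \<mapsto> S' N' X - X S N\<close> commuting with it, where \<open>U = 1 + N\<close> and \<open>U' = 1 + N'\<close>. Hence
  a power of \<open>D\<close> annihilates \<open>F\<close>, and so does \<open>D\<close> itself.\<close>

lemma dunford_natural_ss:
  assumes A: "dunford A S U" "A \<in> carrier_mat n n"
    and B: "dunford B S' U'" "B \<in> carrier_mat m m"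
    and F: "F \<in> carrier_mat m n" "F * A = B * F"
  shows "F * S = S' * F"
proof -
  from dunfordE[OF A] obtain c Q Q' k1 where
    S: "S \<in> carrier_mat n n" "U \<in> carrier_mat n n" "A = S * U" "S * U = U * S"
    "similar_mat_wit S (mat_diag n c) Q Q'" "(U - 1\<^sub>m n) ^\<^sub>m k1 = 0\<^sub>m n n" by metis
  from dunfordE[OF B] obtain d P P' k2 where
    S': "S' \<in> carrier_mat m m" "U' \<in> carrier_mat m m" "B = S' * U'" "S' * U' = U' * S'"
    "similar_mat_wit S' (mat_diag m d) P P'" "(U' - 1\<^sub>m m) ^\<^sub>m k2 = 0\<^sub>m m m" by metis
  note Q = similar_mat_witD_carrier[OF S(5) mat_diag_dim]
  note P = similar_mat_witD_carrier[OF S'(5) mat_diag_dim]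
  define k where "k = max k1 k2"
  define N where "N = U - 1\<^sub>m n"
  define N' where "N' = U' - 1\<^sub>m m"
  have N: "N \<in> carrier_mat n n" "N' \<in> carrier_mat m m"
    using S(2) S'(2) by (auto simp: N_def N'_def)
  note [simp] = carrier_matD[OF F(1)] carrier_matD[OF S(1)] carrier_matD[OF S'(1)]
    carrier_matD[OF S(2)] carrier_matD[OF S'(2)] carrier_matD[OF N(1)] carrier_matD[OF N(2)]
  have SN: "N * S = S * N" and S'N': "N' * S' = S' * N'"
    using S(1,4) S'(1,4) by (simp_all add: N_def N'_def mat_distrib_minus)
  have N_pow: "N ^\<^sub>m i = 0\<^sub>m n n" "N' ^\<^sub>m i = 0\<^sub>m m m" if "k \<le> i" for i
    using pow_mat_zero_mono[OF N(1), of k1 i] pow_mat_zero_mono[OF N(2), of k2 i] S(6) S'(6) that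
    by (auto simp: N_def N'_def k_def)
  define X where "X s = ((\<lambda>X. X * S - S' * X) ^^ s) F" for s
  have X0: "X 0 = F" and XSuc: "X (Suc s) = X s * S - S' * X s" for s
    by (simp_all add: X_def)
  have X: "X s \<in> carrier_mat m n" for s
    by (induction s) (use F in \<open>auto simp: X0 XSuc intro!: carrier_matI\<close>)
  note [simp] = carrier_matD[OF X]
  have XN: "X (Suc s) = S' * (N' * X s) - X s * (S * N)" for s
  proof (induction s)
    case 0
    have "U = 1\<^sub>m n + N" "U' = 1\<^sub>m m + N'"
      using S(2) S'(2) by (auto simp: N_def N'_def intro!: eq_matI)
    then have "F * S + F * (S * N) = S' * F + S' * (N' * F)"
      using F S(1,3) S'(1,3) by (simp add: mat_distrib mat_mult_assoc)
    from this[unfolded mat_eq_iff] show ?case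
      by (intro eq_matI) (auto simp: X0 XSuc[of 0] algebra_simps simp del: index_mult_mat(1))
  next
    case (Suc s)
    have SN': "N * (S * Y) = S * (N * Y)" if "dim_row Y = n" for Y
      using that SN by (simp flip: mat_mult_assoc)
    have S'N'': "N' * (S' * Y) = S' * (N' * Y)" if "dim_row Y = m" for Y
      using that S'N' by (simp flip: mat_mult_assoc)
    have "X (Suc (Suc s)) = (S' * (N' * X s) - X s * (S * N)) * S - S' * (S' * (N' * X s) - X s * (S * N))"
      by (simp add: XSuc[of "Suc s"] Suc)
    also have "\<dots> = S' * (N' * (X s * S - S' * X s)) - (X s * S - S' * X s) * (S * N)"
      by (simp add: mat_distrib_minus mat_mult_assoc SN SN' S'N'')
        (intro eq_matI; simp add: algebra_simps del: index_mult_mat(1))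
    finally show ?case by (simp add: XSuc)
  qed
  \<comment> \<open>each further step from \<open>X s\<close> contributes a factor \<open>N'\<close> on the left or \<open>N\<close> on the right\<close>
  have "N' ^\<^sub>m i * (X s * N ^\<^sub>m j) = 0\<^sub>m m n" if "k + k \<le> i + j + s" for i j s
    using that
  proof (induction s arbitrary: i j)
    case 0
    then have "k \<le> i \<or> k \<le> j" by auto
    then show ?case
      using N_pow N X[of 0] by auto
  next
    case (Suc s)
    have 1: "N' ^\<^sub>m i * S' = S' * N' ^\<^sub>m i" "N * N ^\<^sub>m j = N ^\<^sub>m j * N" "N ^\<^sub>m Suc j * S = S * N ^\<^sub>m Suc j"
      using pow_mat_mult_commute[OF N(2) N(2) S'(1) S'N'] pow_mat_mult_commute[OF N(1) N(1) S(1) SN]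
        pow_mat_mult_commute[OF N(1) N(1) N(1)] by metis+
    have "N' ^\<^sub>m i * (X (Suc s) * N ^\<^sub>m j)
      = N' ^\<^sub>m i * S' * (N' * (X s * N ^\<^sub>m j)) - N' ^\<^sub>m i * (X s * (S * (N * N ^\<^sub>m j)))"
      by (simp add: XN mat_distrib_minus mat_mult_assoc)
    also have "\<dots> = S' * (N' ^\<^sub>m Suc i * (X s * N ^\<^sub>m j)) - N' ^\<^sub>m i * (X s * (N ^\<^sub>m Suc j * S))"
      by (simp add: 1(1,2) mat_mult_assoc 1(3)[simplified, symmetric] del: pow_mat.simps)
       (simp add: mat_mult_assoc)
    also have "\<dots> = S' * (N' ^\<^sub>m Suc i * (X s * N ^\<^sub>m j)) - N' ^\<^sub>m i * (X s * N ^\<^sub>m Suc j) * S"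
      by (simp add: mat_mult_assoc)
    also have "\<dots> = 0\<^sub>m m n"
      using Suc.IH[of "Suc i" j] Suc.IH[of i "Suc j"] Suc.prems S(1) S'(1)
      by (simp del: pow_mat.simps)
    finally show ?case .
  qed
  from this[of 0 0 "k + k"] have X_zero: "X (k + k) = 0\<^sub>m m n"
    using left_mult_one_mat[OF X] right_mult_one_mat[OF X] by simp
  define G where "G s = P' * X s * Q" for s
  have G: "G s $$ (i, j) = (c j - d i) ^ s * G 0 $$ (i, j)" if "i < m" "j < n" for s i j
  proof (induction s)
    case (Suc s)
    note [simp] = carrier_matD[OF Q(2)] carrier_matD[OF Q(3)] carrier_matD[OF P(2)] carrier_matD[OF P(3)]
      carrier_matD[OF mat_diag_dim]
    have Gs: "G s \<in> carrier_mat m n" by (simp add: G_def carrier_matI)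
    have "G (Suc s) = P' * (X s * S) * Q - P' * (S' * X s) * Q"
      by (simp add: G_def XSuc mat_distrib_minus mat_mult_assoc)
    also have "P' * (X s * S) * Q = G s * mat_diag n c"
      using Q(5) by (simp add: Q(6) G_def mat_mult_assoc right_mult_one_mat[OF mat_diag_dim])
    also have "P' * (S' * X s) * Q = mat_diag m d * G s"
      by (simp add: P(6) G_def mat_mult_assoc mult_cancel_inverse[OF P(5,3,2)])
    finally have "G (Suc s) $$ (i, j) = (c j - d i) * G s $$ (i, j)"
      using that Gs by (simp add: mat_diag_mult_right[OF Gs] mat_diag_mult_left[OF Gs] algebra_simps)
    then show ?case by (simp add: Suc)
  qed simp
  have "G 0 $$ (i, j) * c j = d i * G 0 $$ (i, j)" if "i < m" "j < n" for i j
  proof -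
    have "G (k + k) = 0\<^sub>m m n"
      using P Q by (simp add: G_def X_zero)
    with G[OF that, of "k + k"] that show ?thesis
      by auto
  qed
  then show ?thesis
    unfolding intertwine_diagonalisable_iff[OF S(5) S'(5) F(1)] by (simp add: G_def X0)
qed

lemma objectsE:
  assumes "A \<in> objects"
  obtains n W where "A \<in> carrier_mat n n" "W \<in> carrier_mat n n" "A * W = 1\<^sub>m n" "W * A = 1\<^sub>m n"
proof -
  from assms obtain W where W: "dim_row A = dim_col A" "A * W = 1\<^sub>m (dim_row A)" "W * A = 1\<^sub>m (dim_row W)"
    by (auto simp: objects_def invertible_mat_def inverts_mat_def)
  have "dim_col W = dim_row A" "dim_row W = dim_row A"
    using arg_cong[OF W(2), of dim_col] arg_cong[OF W(3), of dim_col] W(1) by simp_all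
  with W show ?thesis by (intro that[of "dim_row A" W]) auto
qed

lemma objectsI:
  assumes "A \<in> carrier_mat n n" "W \<in> carrier_mat n n" "A * W = 1\<^sub>m n" "W * A = 1\<^sub>m n"
  shows "A \<in> objects"
  using assms by (auto simp: objects_def invertible_mat_def inverts_mat_def)

lemma objects_iff_det:
  assumes "A \<in> carrier_mat n n"
  shows "A \<in> objects \<longleftrightarrow> det A \<noteq> 0"
proof
  assume "A \<in> objects"
  then obtain m W where W: "A \<in> carrier_mat m m" "W \<in> carrier_mat m m" "A * W = 1\<^sub>m m"
    by (metis objectsE)
  from det_mult[OF W(1,2)] W(3) show "det A \<noteq> 0" by auto
next
  assume "det A \<noteq> 0"
  from det_non_zero_imp_unit[OF assms this, of "()"] show "A \<in> objects"
    using objectsI[OF assms] by (auto simp: Units_def ring_mat_def)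
qed

lemma det_jordan_block: "det (jordan_block m c) = (c :: complex) ^ m"
  by (subst det_upper_triangular[of _ m])
    (use diag_jordan_block_pow[of m c 1] in \<open>auto simp: jordan_block_def\<close>)

lemma jordan_block_objects: "c \<noteq> 0 \<Longrightarrow> jordan_block m c \<in> objects"
  by (simp add: objects_iff_det[OF jordan_block_carrier] det_jordan_block)

text \<open>The Jordan normal form as an induction principle. Invertibility of the blocks comes from the
  determinant; a block of size \<open>0\<close> does not determine its eigenvalue, which may then be taken to be \<open>1\<close>.\<close>

lemma objects_induct [consumes 1, case_names block direct_sum similar]:
  assumes A: "A \<in> objects"
    and block: "\<And>m c. c \<noteq> 0 \<Longrightarrow> P (jordan_block m c)"
    and direct_sum: "\<And>n m A B. A \<in> objects \<Longrightarrow> A \<in> carrier_mat n n \<Longrightarrow> B \<in> objects \<Longrightarrow> B \<in> carrier_mat m m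
      \<Longrightarrow> P A \<Longrightarrow> P B \<Longrightarrow> P (four_block_mat A (0\<^sub>m n m) (0\<^sub>m m n) B)"
    and similar: "\<And>A B Q Q'. A \<in> objects \<Longrightarrow> B \<in> objects \<Longrightarrow> similar_mat_wit A B Q Q' \<Longrightarrow> P B \<Longrightarrow> P A"
  shows "P A"
proof -
  obtain n where n: "A \<in> carrier_mat n n"
    using A by (metis objectsE)
  obtain as where as: "char_poly A = (\<Prod>a\<leftarrow>as. [:- a, 1:])"
    using char_poly_factorized[OF n] by blast
  obtain n_as where "similar_mat A (jordan_matrix n_as)"
    using jordan_nf_exists[OF n as] by (auto simp: jordan_nf_def)
  then obtain Q Q' where sim: "similar_mat_wit A (jordan_matrix n_as) Q Q'"
    by (auto simp: similar_mat_def)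
  have "det (jordan_matrix n_as) \<noteq> 0"
    using det_similar[OF \<open>similar_mat A (jordan_matrix n_as)\<close>] A objects_iff_det[OF n] by simp
  have *: "det (jordan_matrix n_as) \<noteq> 0 \<Longrightarrow> P (jordan_matrix n_as)" for n_as :: "(nat \<times> complex) list"
  proof (induction n_as)
    case Nil
    have "jordan_matrix [] = jordan_block 0 (1 :: complex)"
      by (intro eq_matI) (auto simp: jordan_matrix_def)
    then show ?case using block[of 1 0] by simp
  next
    case (Cons x n_as)
    obtain m c where x: "x = (m, c)" by (cases x)
    let ?J = "jordan_matrix n_as" and ?k = "sum_list (map fst n_as)"
    have J: "?J \<in> carrier_mat ?k ?k" by simp
    have "det (jordan_matrix (x # n_as)) = det (jordan_block m c) * det ?J"
      unfolding x jordan_matrix_Cons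
      by (rule det_four_block_mat_lower_left_zero[of _ m _ ?k]) auto
    then have nz: "c ^ m \<noteq> 0" "det (jordan_block m c) \<noteq> 0" "det ?J \<noteq> 0"
      using Cons.prems det_jordan_block[of m c] by auto
    have "P (jordan_block m c)"
    proof (cases "m = 0")
      case True
      then have "jordan_block m c = jordan_block m 1" by (intro eq_matI) auto
      then show ?thesis using block[of 1 m] by simp
    next
      case False
      with nz(1) show ?thesis by (intro block) auto
    qed
    then show ?case
      unfolding x jordan_matrix_Cons using nz(2,3) Cons.IH objects_iff_det[OF J]
        objects_iff_det[OF jordan_block_carrier[of m c]]
      by (intro direct_sum) auto
  qed
  show ?thesis
  proof (rule similar[OF A _ sim *])
    show "jordan_matrix n_as \<in> objects"
      using \<open>det (jordan_matrix n_as) \<noteq> 0\<close> objects_iff_det[OF jordan_matrix_carrier[of n_as]] by simp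
  qed fact
qed

text \<open>The semisimple part is the scalar matrix \<open>c\<close>, and \<open>1 / c\<close> times the block is unipotent.\<close>

lemma dunford_block:
  assumes "c \<noteq> 0"
  shows "\<exists>S U. dunford (jordan_block n c) S U"
proof -
  let ?S = "mat_diag n (\<lambda>_. c)" and ?U = "mat_diag n (\<lambda>_. 1 / c) * jordan_block n c"
  note [simp] = carrier_matD[OF mat_diag_dim]
  have eq: "?U = mat n n (\<lambda>(i, j). if i = j then 1 else if Suc i = j then 1 / c else 0)"
    using assms by (subst mat_diag_mult_left[OF jordan_block_carrier]) (intro eq_matI, auto)
  have "?U - 1\<^sub>m n = mat_diag n (\<lambda>_. 1 / c) * jordan_block n 0"
    unfolding eq by (subst mat_diag_mult_left[OF jordan_block_carrier]) (intro eq_matI, auto)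
  also have "\<dots> ^\<^sub>m n = mat_diag n (\<lambda>_. 1 / c) ^\<^sub>m n * jordan_block n 0 ^\<^sub>m n"
    by (rule pow_mat_mult_distrib[of _ n])
      (simp_all add: mat_diag_mult_left[of _ n n] mat_diag_mult_right[of _ n n] mult.commute)
  also have "jordan_block n (0 :: complex) ^\<^sub>m n = 0\<^sub>m n n"
    by (intro eq_matI) (auto simp: jordan_block_zero_pow)
  also have "mat_diag n (\<lambda>_. 1 / c) ^\<^sub>m n * 0\<^sub>m n n = 0\<^sub>m n n"
    by simp
  finally have "(?U - 1\<^sub>m n) ^\<^sub>m n = 0\<^sub>m n n" .
  moreover have "jordan_block n c = ?S * ?U" "?S * ?U = ?U * ?S"
    unfolding eq using assms
    by (auto simp: mat_diag_mult_left[of _ n n] mat_diag_mult_right[of _ n n] intro!: eq_matI)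
  moreover have "similar_mat_wit ?S ?S (1\<^sub>m n) (1\<^sub>m n)"
    by (rule similar_mat_wit_refl[of _ n]) simp
  ultimately have "dunford (jordan_block n c) ?S ?U"
    by (intro dunfordI[of _ n]) auto
  then show ?thesis by blast
qed

lemma dunford_direct_sum:
  assumes A: "dunford A S U" "A \<in> carrier_mat n n" and B: "dunford B S' U'" "B \<in> carrier_mat m m"
  shows "dunford (four_block_mat A (0\<^sub>m n m) (0\<^sub>m m n) B)
    (four_block_mat S (0\<^sub>m n m) (0\<^sub>m m n) S') (four_block_mat U (0\<^sub>m n m) (0\<^sub>m m n) U')"
proof -
  from dunfordE[OF A] obtain c Q Q' k1 where
    S: "S \<in> carrier_mat n n" "U \<in> carrier_mat n n" "A = S * U" "S * U = U * S"
    "similar_mat_wit S (mat_diag n c) Q Q'" "(U - 1\<^sub>m n) ^\<^sub>m k1 = 0\<^sub>m n n" by metis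
  from dunfordE[OF B] obtain d P P' k2 where
    S': "S' \<in> carrier_mat m m" "U' \<in> carrier_mat m m" "B = S' * U'" "S' * U' = U' * S'"
    "similar_mat_wit S' (mat_diag m d) P P'" "(U' - 1\<^sub>m m) ^\<^sub>m k2 = 0\<^sub>m m m" by metis
  let ?f = "\<lambda>X Y :: complex mat. four_block_mat X (0\<^sub>m n m) (0\<^sub>m m n) Y"
  have mult: "?f X Y * ?f X' Y' = ?f (X * X') (Y * Y')"
    if "X \<in> carrier_mat n n" "X' \<in> carrier_mat n n" "Y \<in> carrier_mat m m" "Y' \<in> carrier_mat m m" for X X' Y Y'
    using that by (subst mult_four_block_mat[of _ n n _ m _ m]) auto
  have "?f (mat_diag n c) (mat_diag m d) = mat_diag (n + m) (\<lambda>i. if i < n then c i else d (i - n))"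
    by (intro eq_matI) (auto simp: mat_diag_def)
  moreover have "similar_mat_wit (?f S S') (?f (mat_diag n c) (mat_diag m d)) (?f Q P) (?f Q' P')"
    by (rule similar_mat_wit_four_block[OF S(5) S'(5) _ _ S(1) S'(1)])
      (use similar_mat_witD_carrier[OF S(5) mat_diag_dim] similar_mat_witD_carrier[OF S'(5) mat_diag_dim] in auto)
  ultimately have sim: "similar_mat_wit (?f S S') (mat_diag (n + m) (\<lambda>i. if i < n then c i else d (i - n))) (?f Q P) (?f Q' P')"
    by simp
  define k where "k = max k1 k2"
  have N: "U - 1\<^sub>m n \<in> carrier_mat n n" "U' - 1\<^sub>m m \<in> carrier_mat m m"
    using S(2) S'(2) by (auto intro!: carrier_matI)
  have "?f U U' - 1\<^sub>m (n + m) = ?f (U - 1\<^sub>m n) (U' - 1\<^sub>m m)"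
    using S(2) S'(2) by (intro eq_matI) auto
  also have "\<dots> ^\<^sub>m k = ?f ((U - 1\<^sub>m n) ^\<^sub>m k) ((U' - 1\<^sub>m m) ^\<^sub>m k)"
    by (rule pow_four_block_mat[OF N])
  also have "\<dots> = ?f (0\<^sub>m n n) (0\<^sub>m m m)"
    using pow_mat_zero_mono[OF N(1) S(6), of k] pow_mat_zero_mono[OF N(2) S'(6), of k] by (simp add: k_def)
  also have "\<dots> = 0\<^sub>m (n + m) (n + m)"
    by (intro eq_matI) auto
  finally have nil: "(?f U U' - 1\<^sub>m (n + m)) ^\<^sub>m k = 0\<^sub>m (n + m) (n + m)" .
  show ?thesis
    by (rule dunfordI[OF _ _ _ _ sim nil]) (use S(1-4) S'(1-4) in \<open>simp_all add: mult\<close>)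
qed

lemma dunford_similar:
  assumes A: "similar_mat_wit A B P P'" and B: "dunford B S U" "B \<in> carrier_mat n n"
  shows "dunford A (P * S * P') (P * U * P')"
proof -
  from dunfordE[OF B] obtain c Q Q' k where
    S: "S \<in> carrier_mat n n" "U \<in> carrier_mat n n" "B = S * U" "S * U = U * S"
    "similar_mat_wit S (mat_diag n c) Q Q'" "(U - 1\<^sub>m n) ^\<^sub>m k = 0\<^sub>m n n" by metis
  note P = similar_mat_witD_carrier[OF A B(2)]
  note [simp] = carrier_matD[OF P(2)] carrier_matD[OF P(3)] carrier_matD[OF S(1)] carrier_matD[OF S(2)]
  have conj: "similar_mat_wit (P * X * P') X P P'" if "X \<in> carrier_mat n n" for X
    using that P(2-5) by (simp add: similar_mat_wit_def Let_def mult_carrier_mat[of _ n n])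
  have mult: "P * X * P' * (P * Y * P') = P * (X * Y) * P'"
    if "X \<in> carrier_mat n n" "Y \<in> carrier_mat n n" for X Y
    using that P(2,3) by (simp add: mat_mult_assoc mult_cancel_inverse[OF P(5,3,2)])
  have sim: "similar_mat_wit (P * S * P') (mat_diag n c) (P * Q) (Q' * P')"
    by (rule similar_mat_wit_trans[OF conj[OF S(1)] S(5)])
  have "P * U * P' - 1\<^sub>m n = P * (U - 1\<^sub>m n) * P'"
    using P(2-4) by (simp add: mat_distrib_minus)
  also have "(P * (U - 1\<^sub>m n) * P') ^\<^sub>m k = P * (U - 1\<^sub>m n) ^\<^sub>m k * P'"
    by (rule similar_mat_wit_pow_id[OF conj]) (use S(2) in \<open>auto intro!: carrier_matI\<close>)
  also have "\<dots> = 0\<^sub>m n n"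
    using P(2,3) by (simp add: S(6))
  finally have nil: "(P * U * P' - 1\<^sub>m n) ^\<^sub>m k = 0\<^sub>m n n" .
  show ?thesis
    by (rule dunfordI[OF _ _ _ _ sim nil])
      (auto simp: mult[OF S(1,2)] mult[OF S(2,1)] P(6) S(3,4) intro!: carrier_matI)
qed

lemma dunford_exists:
  assumes "A \<in> objects"
  shows "\<exists>S U. dunford A S U"
  using assms
proof (induction rule: objects_induct)
  case (similar A B Q Q')
  then show ?case using dunford_similar objectsE by metis
qed (use dunford_block dunford_direct_sum in blast)+

text \<open>Invertibility is what separates the two factors: it makes \<open>S\<close> invertible, so that intertwining
  \<open>A = S U\<close> and \<open>S\<close> forces intertwining \<open>U\<close>.\<close>

lemma dunford_ss_left_inverse:
  assumes "dunford A S U" "A \<in> objects" "A \<in> carrier_mat n n"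
  obtains L where "L \<in> carrier_mat n n" "L * S = 1\<^sub>m n"
proof -
  from dunfordE[OF assms(1,3)] have
    S: "S \<in> carrier_mat n n" "U \<in> carrier_mat n n" "A = S * U" "S * U = U * S" by metis+
  from assms(2,3) obtain W where W: "W \<in> carrier_mat n n" "W * A = 1\<^sub>m n"
    by (metis objectsE carrier_matD(1))
  have "W * U * S = 1\<^sub>m n"
    using W S(1,2) by (simp add: S(3,4) mat_mult_assoc)
  then show ?thesis using W(1) S(2) by (intro that[of "W * U"]) auto
qed

lemma dunford_natural_un:
  assumes A: "dunford A S U" "A \<in> carrier_mat n n"
    and B: "dunford B S' U'" "B \<in> carrier_mat m m" "B \<in> objects"
    and F: "F \<in> carrier_mat m n" "F * A = B * F"
  shows "F * U = U' * F"
proof -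
  from dunfordE[OF A] have S: "S \<in> carrier_mat n n" "U \<in> carrier_mat n n" "A = S * U" by metis+
  from dunfordE[OF B(1,2)] have S': "S' \<in> carrier_mat m m" "U' \<in> carrier_mat m m" "B = S' * U'" by metis+
  obtain L where L: "L \<in> carrier_mat m m" "L * S' = 1\<^sub>m m"
    using dunford_ss_left_inverse[OF B(1,3,2)] .
  note [simp] = carrier_matD[OF F(1)] carrier_matD[OF S(1)] carrier_matD[OF S'(1)]
    carrier_matD[OF S(2)] carrier_matD[OF S'(2)] carrier_matD[OF L(1)]
  have "L * S' * (F * U) = L * (F * S * U)"
    by (simp add: mat_mult_assoc dunford_natural_ss[OF A B(1,2) F])
  also have "F * S * U = S' * (U' * F)"
    using F(2) by (simp add: mat_mult_assoc S(3) S'(3))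
  also have "L * (S' * (U' * F)) = L * S' * (U' * F)"
    by (simp add: mat_mult_assoc)
  finally show ?thesis by (simp add: L(2))
qed

text \<open>The homomorphism \<open>\<gamma>\<close> is only meaningful on nonzero numbers, so every use of it on the
  eigenvalues of the semisimple part rests on this fact.\<close>

lemma dunford_eigenvalues_nonzero:
  assumes "dunford A S U" "A \<in> objects" "A \<in> carrier_mat n n"
    and sim: "similar_mat_wit S (mat_diag n c) Q Q'" and "i < n"
  shows "c i \<noteq> 0"
proof
  assume "c i = 0"
  note Q = similar_mat_witD_carrier[OF sim mat_diag_dim]
  note [simp] = carrier_matD[OF Q(2)] carrier_matD[OF Q(3)] carrier_matD[OF mat_diag_dim]
  obtain L where L: "L \<in> carrier_mat n n" "L * S = 1\<^sub>m n"
    using dunford_ss_left_inverse[OF assms(1-3)] .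
  note [simp] = carrier_matD[OF L(1)]
  define M where "M = Q' * L * Q"
  have M: "M \<in> carrier_mat n n" by (simp add: M_def carrier_matI)
  have "M * mat_diag n c = Q' * (L * S) * Q"
    using Q(5) by (simp add: M_def Q(6) mat_mult_assoc right_mult_one_mat[OF mat_diag_dim])
  also have "\<dots> = 1\<^sub>m n"
    using Q(2,3,5) by (simp add: L(2))
  finally have "(M * mat_diag n c) $$ (i, i) = 1" using \<open>i < n\<close> by simp
  then show False
    using \<open>c i = 0\<close> \<open>i < n\<close> by (simp add: mat_diag_mult_right[OF M])
qed

lemma dunford_unique:
  assumes "A \<in> objects" "dunford A S U" "dunford A S' U'"
  shows "S = S'" "U = U'"
proof -
  from assms(1) obtain n where A: "A \<in> carrier_mat n n" by (metis objectsE)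
  have 1: "1\<^sub>m n * A = A * 1\<^sub>m n" using A by simp
  have *: "S \<in> carrier_mat n n" "U \<in> carrier_mat n n" "S' \<in> carrier_mat n n" "U' \<in> carrier_mat n n"
    using dunfordE[OF assms(2) A] dunfordE[OF assms(3) A] by metis+
  show "S = S'"
    using dunford_natural_ss[OF assms(2) A assms(3) A one_carrier_mat 1] * by simp
  show "U = U'"
    using dunford_natural_un[OF assms(2) A assms(3) A assms(1) one_carrier_mat 1] * by simp
qed

lemma dunford_parts_eq:
  assumes "A \<in> objects" "dunford A S U"
  shows "ss_part A = S" "un_part A = U"
  using assms dunford_unique[OF assms(1)] unfolding ss_part_def un_part_def by (blast intro!: the_equality)+

text \<open>The unipotence of \<open>U \<otimes> U'\<close> comes from
  \<open>U \<otimes> U' - 1 = (U - 1) \<otimes> 1 + U \<otimes> (U' - 1)\<close>, a sum of two commuting nilpotent matrices.\<close>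

lemma dunford_kronecker:
  assumes A: "dunford A S U" "A \<in> carrier_mat n n" and B: "dunford B S' U'" "B \<in> carrier_mat m m"
  shows "dunford (kronecker A B) (kronecker S S') (kronecker U U')"
proof -
  from dunfordE[OF A] obtain c Q Q' k1 where
    S: "S \<in> carrier_mat n n" "U \<in> carrier_mat n n" "A = S * U" "S * U = U * S"
    "similar_mat_wit S (mat_diag n c) Q Q'" "(U - 1\<^sub>m n) ^\<^sub>m k1 = 0\<^sub>m n n" by metis
  from dunfordE[OF B] obtain d P P' k2 where
    S': "S' \<in> carrier_mat m m" "U' \<in> carrier_mat m m" "B = S' * U'" "S' * U' = U' * S'"
    "similar_mat_wit S' (mat_diag m d) P P'" "(U' - 1\<^sub>m m) ^\<^sub>m k2 = 0\<^sub>m m m" by metis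
  note [simp] = carrier_matD[OF S(1)] carrier_matD[OF S'(1)] carrier_matD[OF S(2)] carrier_matD[OF S'(2)]
  define k where "k = max k1 k2"
  have N: "U - 1\<^sub>m n \<in> carrier_mat n n" "U' - 1\<^sub>m m \<in> carrier_mat m m"
    by (auto intro!: carrier_matI)
  have Nk: "(U - 1\<^sub>m n) ^\<^sub>m k = 0\<^sub>m n n" "(U' - 1\<^sub>m m) ^\<^sub>m k = 0\<^sub>m m m"
    using pow_mat_zero_mono[OF N(1) S(6), of k] pow_mat_zero_mono[OF N(2) S'(6), of k] by (simp_all add: k_def)
  let ?X = "kronecker (U - 1\<^sub>m n) (1\<^sub>m m)" and ?Y = "kronecker U (U' - 1\<^sub>m m)"
  have XY: "?X \<in> carrier_mat (n * m) (n * m)" "?Y \<in> carrier_mat (n * m) (n * m)"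
    by (auto intro!: carrier_matI)
  have "?X * ?Y = ?Y * ?X"
    using S(2) N(2) by (simp add: kronecker_mult mat_distrib_minus)
  moreover have "?X ^\<^sub>m k = 0\<^sub>m (n * m) (n * m)"
    by (subst pow_mat_kronecker[OF N(1) one_carrier_mat]) (simp add: Nk kronecker_zero)
  moreover have "?Y ^\<^sub>m k = 0\<^sub>m (n * m) (n * m)"
    by (subst pow_mat_kronecker[OF S(2) N(2)]) (simp add: Nk kronecker_zero)
  ultimately have "(?X + ?Y) ^\<^sub>m (k + k) = 0\<^sub>m (n * m) (n * m)"
    by (intro nilpotent_add XY)
  also have "?X + ?Y = kronecker U U' - 1\<^sub>m (n * m)"
  proof -
    have "U = 1\<^sub>m n + (U - 1\<^sub>m n)" "U' = 1\<^sub>m m + (U' - 1\<^sub>m m)"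
      by (intro eq_matI; simp)+
    then have "kronecker U U' = kronecker (1\<^sub>m n) (1\<^sub>m m) + kronecker (U - 1\<^sub>m n) (1\<^sub>m m) + ?Y"
      using kronecker_add_right[OF one_carrier_mat N(2), of U] kronecker_add_left[OF one_carrier_mat N(1), of "1\<^sub>m m"]
      by simp
    then show ?thesis
      by (intro eq_matI) (simp_all add: kronecker_one)
  qed
  finally have nil: "(kronecker U U' - 1\<^sub>m (n * m)) ^\<^sub>m (k + k) = 0\<^sub>m (n * m) (n * m)" .
  have sim: "similar_mat_wit (kronecker S S') (mat_diag (n * m) (\<lambda>i. c (i div m) * d (i mod m)))
     (kronecker Q P) (kronecker Q' P')"
    using similar_mat_wit_kronecker[OF S(5) mat_diag_dim S'(5) mat_diag_dim] by (simp only: kronecker_mat_diag)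
  show ?thesis
    by (rule dunfordI[OF _ _ _ _ sim nil])
      (auto simp: kronecker_mult S(3,4) S'(3,4) intro!: carrier_matI)
qed

section \<open>Complex powers of unipotent matrices\<close>

definition poly_fun :: "(complex \<Rightarrow> complex) \<Rightarrow> bool" where
  "poly_fun f \<longleftrightarrow> (\<exists>p. \<forall>x. f x = poly p x)"

lemma poly_fun_const: "poly_fun (\<lambda>_. c)"
  unfolding poly_fun_def by (rule exI[of _ "[:c:]"]) auto

lemma poly_fun_id: "poly_fun (\<lambda>x. x)"
  unfolding poly_fun_def by (rule exI[of _ "[:0, 1:]"]) auto

lemma poly_fun_add: "poly_fun f \<Longrightarrow> poly_fun g \<Longrightarrow> poly_fun (\<lambda>x. f x + g x)"
  unfolding poly_fun_def by (metis poly_add)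

lemma poly_fun_mult: "poly_fun f \<Longrightarrow> poly_fun g \<Longrightarrow> poly_fun (\<lambda>x. f x * g x)"
  unfolding poly_fun_def by (metis poly_mult)

lemma poly_fun_compose: "poly_fun f \<Longrightarrow> poly_fun g \<Longrightarrow> poly_fun (\<lambda>x. f (g x))"
  unfolding poly_fun_def by (metis poly_pcompose)

lemma poly_fun_sum: "(\<And>i. i \<in> I \<Longrightarrow> poly_fun (f i)) \<Longrightarrow> poly_fun (\<lambda>x. \<Sum>i\<in>I. f i x)"
  by (induction I rule: infinite_finite_induct) (auto intro: poly_fun_const poly_fun_add)

lemma poly_fun_prod: "(\<And>i. i \<in> I \<Longrightarrow> poly_fun (f i)) \<Longrightarrow> poly_fun (\<lambda>x. \<Prod>i\<in>I. f i x)"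
  by (induction I rule: infinite_finite_induct) (auto intro: poly_fun_const poly_fun_mult)

lemma poly_fun_gbinomial: "poly_fun (\<lambda>x. x gchoose k)"
proof -
  have "poly_fun (\<lambda>x. (\<Prod>i = 0..<k. x + (- of_nat i)) * (1 / fact k))"
    by (intro poly_fun_mult poly_fun_prod poly_fun_add poly_fun_id poly_fun_const)
  then show ?thesis by (simp add: gbinomial_prod_rev)
qed

lemma poly_fun_eqI:
  assumes "poly_fun f" "poly_fun g" "\<And>n :: nat. f (of_nat n) = g (of_nat n)"
  shows "f = g"
proof -
  obtain p r where p: "\<And>x. f x = poly p x" "\<And>x. g x = poly r x"
    using assms(1,2) unfolding poly_fun_def by blast
  have "range (of_nat :: nat \<Rightarrow> complex) \<subseteq> {x. poly (p - r) x = 0}"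
    using assms(3) by (auto simp: p)
  moreover have "infinite (range (of_nat :: nat \<Rightarrow> complex))"
    by (rule range_inj_infinite) (simp add: inj_of_nat)
  ultimately have "infinite {x. poly (p - r) x = 0}"
    using finite_subset by blast
  then have "p - r = 0"
    using poly_roots_finite by blast
  then show ?thesis by (simp add: p fun_eq_iff)
qed

lemma dim_unipotent_power [simp]:
  "dim_row (unipotent_power U \<mu>) = dim_row U" "dim_col (unipotent_power U \<mu>) = dim_row U"
  by (simp_all add: unipotent_power_def Let_def)

lemma unipotent_power_index:
  assumes U: "U \<in> carrier_mat n n" "(U - 1\<^sub>m n) ^\<^sub>m k = 0\<^sub>m n n" and ij: "i < n" "j < n"
  shows "unipotent_power U \<mu> $$ (i, j) = (\<Sum>l<k. (\<mu> gchoose l) * ((U - 1\<^sub>m n) ^\<^sub>m l) $$ (i, j))"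
proof -
  have N: "U - 1\<^sub>m n \<in> carrier_mat n n" by (simp add: minus_carrier_mat)
  have "(\<Sum>l. (\<mu> gchoose l) * ((U - 1\<^sub>m n) ^\<^sub>m l) $$ (i, j))
      = (\<Sum>l<k. (\<mu> gchoose l) * ((U - 1\<^sub>m n) ^\<^sub>m l) $$ (i, j))"
    by (rule suminf_finite) (use pow_mat_zero_mono[OF N U(2)] ij in auto)
  then show ?thesis
    using U(1) ij by (simp add: unipotent_power_def Let_def)
qed

lemma unipotent_power_mult_index:
  assumes U: "U \<in> carrier_mat n n" "(U - 1\<^sub>m n) ^\<^sub>m k = 0\<^sub>m n n"
    and X: "X \<in> carrier_mat n m" and ij: "i < n" "j < m"
  shows "(unipotent_power U \<mu> * X) $$ (i, j) = (\<Sum>l<k. (\<mu> gchoose l) * ((U - 1\<^sub>m n) ^\<^sub>m l * X) $$ (i, j))"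
proof -
  note [simp] = carrier_matD[OF U(1)] carrier_matD[OF X]
  have "(unipotent_power U \<mu> * X) $$ (i, j)
     = (\<Sum>r<n. (\<Sum>l<k. (\<mu> gchoose l) * ((U - 1\<^sub>m n) ^\<^sub>m l) $$ (i, r)) * X $$ (r, j))"
    using ij by (subst index_mult_mat_sum) (auto simp: unipotent_power_index[OF U])
  also have "\<dots> = (\<Sum>l<k. (\<mu> gchoose l) * (\<Sum>r<n. ((U - 1\<^sub>m n) ^\<^sub>m l) $$ (i, r) * X $$ (r, j)))"
    unfolding sum_distrib_left sum_distrib_right by (subst sum.swap) (simp add: mult_ac)
  also have "\<dots> = (\<Sum>l<k. (\<mu> gchoose l) * ((U - 1\<^sub>m n) ^\<^sub>m l * X) $$ (i, j))"
    using ij by (intro sum.cong refl arg_cong2[of _ _ _ _ "(*)"], subst index_mult_mat_sum) auto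
  finally show ?thesis .
qed

lemma mult_unipotent_power_index:
  assumes U: "U \<in> carrier_mat n n" "(U - 1\<^sub>m n) ^\<^sub>m k = 0\<^sub>m n n"
    and X: "X \<in> carrier_mat m n" and ij: "i < m" "j < n"
  shows "(X * unipotent_power U \<mu>) $$ (i, j) = (\<Sum>l<k. (\<mu> gchoose l) * (X * (U - 1\<^sub>m n) ^\<^sub>m l) $$ (i, j))"
proof -
  note [simp] = carrier_matD[OF U(1)] carrier_matD[OF X]
  have "(X * unipotent_power U \<mu>) $$ (i, j)
     = (\<Sum>r<n. X $$ (i, r) * (\<Sum>l<k. (\<mu> gchoose l) * ((U - 1\<^sub>m n) ^\<^sub>m l) $$ (r, j)))"
    using ij by (subst index_mult_mat_sum) (auto simp: unipotent_power_index[OF U])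
  also have "\<dots> = (\<Sum>l<k. (\<mu> gchoose l) * (\<Sum>r<n. X $$ (i, r) * ((U - 1\<^sub>m n) ^\<^sub>m l) $$ (r, j)))"
    unfolding sum_distrib_left by (subst sum.swap) (simp add: mult_ac)
  also have "\<dots> = (\<Sum>l<k. (\<mu> gchoose l) * (X * (U - 1\<^sub>m n) ^\<^sub>m l) $$ (i, j))"
    using ij by (intro sum.cong refl arg_cong2[of _ _ _ _ "(*)"], subst index_mult_mat_sum) auto
  finally show ?thesis .
qed

lemma unipotent_power_natural:
  assumes U: "U \<in> carrier_mat n n" "(U - 1\<^sub>m n) ^\<^sub>m k = 0\<^sub>m n n"
    and V: "V \<in> carrier_mat m m" "(V - 1\<^sub>m m) ^\<^sub>m l = 0\<^sub>m m m"
    and F: "F \<in> carrier_mat m n" "F * U = V * F"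
  shows "F * unipotent_power U \<mu> = unipotent_power V \<mu> * F"
proof -
  note [simp] = carrier_matD[OF U(1)] carrier_matD[OF V(1)] carrier_matD[OF F(1)]
  define K where "K = max k l"
  have N: "U - 1\<^sub>m n \<in> carrier_mat n n" "V - 1\<^sub>m m \<in> carrier_mat m m"
    by (simp_all add: minus_carrier_mat)
  have K: "(U - 1\<^sub>m n) ^\<^sub>m K = 0\<^sub>m n n" "(V - 1\<^sub>m m) ^\<^sub>m K = 0\<^sub>m m m"
    using pow_mat_zero_mono[OF N(1) U(2), of K] pow_mat_zero_mono[OF N(2) V(2), of K] by (simp_all add: K_def)
  have "(V - 1\<^sub>m m) * F = F * (U - 1\<^sub>m n)"
    using F by (simp add: mat_distrib_minus)
  from pow_mat_mult_commute[OF N(2,1) F(1) this]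
  have "F * (U - 1\<^sub>m n) ^\<^sub>m i = (V - 1\<^sub>m m) ^\<^sub>m i * F" for i by simp
  then show ?thesis
    by (intro eq_matI) (simp_all del: index_mult_mat(1)
        add: unipotent_power_mult_index[OF V(1) K(2) F(1)] mult_unipotent_power_index[OF U(1) K(1) F(1)])
qed

lemma unipotent_power_0:
  assumes U: "U \<in> carrier_mat n n" "(U - 1\<^sub>m n) ^\<^sub>m k = 0\<^sub>m n n"
  shows "unipotent_power U 0 = 1\<^sub>m n"
proof (intro eq_matI)
  note [simp] = carrier_matD[OF U(1)]
  fix i j assume ij: "i < dim_row (1\<^sub>m n)" "j < dim_col (1\<^sub>m n)"
  have N: "U - 1\<^sub>m n \<in> carrier_mat n n" by (simp add: minus_carrier_mat)
  have "unipotent_power U 0 $$ (i, j) = (\<Sum>l<Suc k. (0 gchoose l) * ((U - 1\<^sub>m n) ^\<^sub>m l) $$ (i, j))"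
    by (rule unipotent_power_index) (use U ij pow_mat_zero_mono[OF N U(2), of "Suc k"] in auto)
  also have "\<dots> = 1\<^sub>m n $$ (i, j)"
    by (subst sum.lessThan_Suc_shift) (simp add: gbinomial_0)
  finally show "unipotent_power U 0 $$ (i, j) = 1\<^sub>m n $$ (i, j)" .
qed (use U in auto)

text \<open>Pascal's rule. Together with the value at \<open>0\<close>, this recursion determines the power at all natural
  exponents and hence, by polynomiality, at all complex exponents.\<close>

lemma unipotent_power_add_1:
  assumes U: "U \<in> carrier_mat n n" "(U - 1\<^sub>m n) ^\<^sub>m k = 0\<^sub>m n n"
  shows "unipotent_power U (\<mu> + 1) = unipotent_power U \<mu> * U"
proof (intro eq_matI)
  note [simp] = carrier_matD[OF U(1)]
  fix i j assume ij: "i < dim_row (unipotent_power U \<mu> * U)" "j < dim_col (unipotent_power U \<mu> * U)"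
  let ?N = "U - 1\<^sub>m n"
  define a where "a l = (?N ^\<^sub>m l) $$ (i, j)" for l
  have N: "?N \<in> carrier_mat n n" by (simp add: minus_carrier_mat)
  have Suck: "?N ^\<^sub>m Suc k = 0\<^sub>m n n"
    by (rule pow_mat_zero_mono[OF N U(2)]) simp
  have "U = 1\<^sub>m n + ?N" by (intro eq_matI) auto
  then have "?N ^\<^sub>m l * U = ?N ^\<^sub>m l * (1\<^sub>m n + ?N)" for l by simp
  also have "?N ^\<^sub>m l * (1\<^sub>m n + ?N) = ?N ^\<^sub>m l + ?N ^\<^sub>m Suc l" for l
    using right_mult_one_mat[OF pow_carrier_mat[OF N]] by (simp add: mat_distrib)
  finally have "?N ^\<^sub>m l * U = ?N ^\<^sub>m l + ?N ^\<^sub>m Suc l" for l .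
  then have step: "(?N ^\<^sub>m l * U) $$ (i, j) = a l + a (Suc l)" for l
    using ij by (simp add: a_def del: pow_mat.simps)
  have ak: "a (Suc k) = 0" using ij unfolding a_def Suck by simp
  have "(unipotent_power U \<mu> * U) $$ (i, j) = (\<Sum>l<Suc k. (\<mu> gchoose l) * (a l + a (Suc l)))"
    using ij by (subst unipotent_power_mult_index[OF U(1) Suck U(1)]) (auto simp: step)
  also have "\<dots> = a 0 + (\<Sum>l<k. (\<mu> gchoose Suc l) * a (Suc l)) + (\<Sum>l<k. (\<mu> gchoose l) * a (Suc l))"
    by (simp only: distrib_left sum.distrib sum.lessThan_Suc_shift[of "\<lambda>l. (\<mu> gchoose l) * a l"]
        sum.lessThan_Suc[of "\<lambda>l. (\<mu> gchoose l) * a (Suc l)"] ak) simp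
  also have "\<dots> = (\<Sum>l<Suc k. (\<mu> + 1 gchoose l) * a l)"
    by (subst sum.lessThan_Suc_shift) (simp add: gbinomial_Suc_Suc distrib_right sum.distrib)
  also have "\<dots> = unipotent_power U (\<mu> + 1) $$ (i, j)"
    using ij by (subst unipotent_power_index[OF U(1) Suck]) (auto simp: a_def)
  finally show "unipotent_power U (\<mu> + 1) $$ (i, j) = (unipotent_power U \<mu> * U) $$ (i, j)" ..
qed (use U in auto)

lemma poly_fun_unipotent_power:
  assumes U: "U \<in> carrier_mat n n" "(U - 1\<^sub>m n) ^\<^sub>m k = 0\<^sub>m n n" and ij: "i < n" "j < n"
  shows "poly_fun (\<lambda>\<mu>. unipotent_power U \<mu> $$ (i, j))"
  unfolding unipotent_power_index[OF assms]
  by (intro poly_fun_sum poly_fun_mult poly_fun_gbinomial poly_fun_const)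

text \<open>The entries of both sides are polynomials in the exponent, and for natural exponents the identity
  is the multiplicativity of ordinary powers.\<close>

lemma unipotent_power_kronecker:
  assumes U: "U \<in> carrier_mat n n" "(U - 1\<^sub>m n) ^\<^sub>m k = 0\<^sub>m n n"
    and V: "V \<in> carrier_mat m m" "(V - 1\<^sub>m m) ^\<^sub>m l = 0\<^sub>m m m"
    and UV: "(kronecker U V - 1\<^sub>m (n * m)) ^\<^sub>m r = 0\<^sub>m (n * m) (n * m)"
  shows "unipotent_power (kronecker U V) \<mu> = kronecker (unipotent_power U \<mu>) (unipotent_power V \<mu>)"
proof (intro eq_matI)
  note [simp] = carrier_matD[OF U(1)] carrier_matD[OF V(1)]
  have UV1: "kronecker U V \<in> carrier_mat (n * m) (n * m)" by (intro kronecker_carrier U V)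
  fix i j assume "i < dim_row (kronecker (unipotent_power U \<mu>) (unipotent_power V \<mu>))"
    "j < dim_col (kronecker (unipotent_power U \<mu>) (unipotent_power V \<mu>))"
  then have ij: "i < n * m" "j < n * m" by auto
  have nat: "unipotent_power (kronecker U V) (of_nat a) = kronecker (unipotent_power U (of_nat a)) (unipotent_power V (of_nat a))"
    for a :: nat
  proof (induction a)
    case 0
    then show ?case
      by (simp add: unipotent_power_0[OF U] unipotent_power_0[OF V] unipotent_power_0[OF UV1 UV] kronecker_one)
  next
    case (Suc a)
    have "of_nat (Suc a) = of_nat a + (1 :: complex)" by simp
    then show ?case
      by (simp only: unipotent_power_add_1[OF U] unipotent_power_add_1[OF V] unipotent_power_add_1[OF UV1 UV] Suc)
        (simp add: kronecker_mult)
  qed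
  have "(\<lambda>\<mu>. unipotent_power (kronecker U V) \<mu> $$ (i, j)) = (\<lambda>\<mu>. unipotent_power U \<mu> $$ (i div m, j div m) *
     unipotent_power V \<mu> $$ (i mod m, j mod m))"
    by (rule poly_fun_eqI)
      (use ij in \<open>auto simp: div_mod_less nat
        intro!: poly_fun_mult poly_fun_unipotent_power[OF U] poly_fun_unipotent_power[OF V] poly_fun_unipotent_power[OF UV1 UV]\<close>)
  from fun_cong[OF this, of \<mu>]
  show "unipotent_power (kronecker U V) \<mu> $$ (i, j) = kronecker (unipotent_power U \<mu>) (unipotent_power V \<mu>) $$ (i, j)"
    using ij by simp
qed auto

lemma unipotent_power_uminus:
  assumes U: "U \<in> carrier_mat n n" "(U - 1\<^sub>m n) ^\<^sub>m k = 0\<^sub>m n n"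
  shows "unipotent_power U \<mu> * unipotent_power U (- \<mu>) = 1\<^sub>m n"
proof (intro eq_matI)
  note [simp] = carrier_matD[OF U(1)]
  fix i j assume "i < dim_row (1\<^sub>m n)" "j < dim_col (1\<^sub>m n)"
  then have ij: "i < n" "j < n" by auto
  have nat: "unipotent_power U (of_nat a) * unipotent_power U (- of_nat a) = 1\<^sub>m n" for a :: nat
  proof (induction a)
    case 0
    then show ?case by (simp add: unipotent_power_0[OF U])
  next
    case (Suc a)
    have *: "of_nat (Suc a) = of_nat a + (1 :: complex)" "- of_nat a = - of_nat (Suc a) + (1 :: complex)" by simp_all
    have "unipotent_power U (of_nat (Suc a)) * unipotent_power U (- of_nat (Suc a))
      = unipotent_power U (of_nat a) * (U * unipotent_power U (- of_nat (Suc a)))"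
      by (simp only: *(1) unipotent_power_add_1[OF U]) (simp add: mat_mult_assoc)
    also have "U * unipotent_power U (- of_nat (Suc a)) = unipotent_power U (- of_nat (Suc a)) * U"
      by (rule unipotent_power_natural[OF U U U(1) refl])
    also have "\<dots> = unipotent_power U (- of_nat a)"
      by (simp only: *(2) unipotent_power_add_1[OF U])
    finally show ?case by (simp only: Suc)
  qed
  have "(\<lambda>\<mu>. \<Sum>r<n. unipotent_power U \<mu> $$ (i, r) * unipotent_power U (- \<mu>) $$ (r, j)) = (\<lambda>_. 1\<^sub>m n $$ (i, j))"
  proof (rule poly_fun_eqI)
    have "poly_fun uminus"
      using poly_fun_mult[OF poly_fun_const[of "-1"] poly_fun_id] by simp
    then show "poly_fun (\<lambda>\<mu>. \<Sum>r<n. unipotent_power U \<mu> $$ (i, r) * unipotent_power U (- \<mu>) $$ (r, j))"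
      using ij by (intro poly_fun_sum poly_fun_mult poly_fun_unipotent_power[OF U]
          poly_fun_compose[OF poly_fun_unipotent_power[OF U]]) auto
  next
    fix a :: nat
    show "(\<Sum>r<n. unipotent_power U (of_nat a) $$ (i, r) * unipotent_power U (- of_nat a) $$ (r, j)) = 1\<^sub>m n $$ (i, j)"
      unfolding nat[of a, symmetric] using ij by (subst index_mult_mat_sum) auto
  qed (rule poly_fun_const)
  from fun_cong[OF this, of \<mu>]
  show "(unipotent_power U \<mu> * unipotent_power U (- \<mu>)) $$ (i, j) = 1\<^sub>m n $$ (i, j)"
    using ij by (simp add: index_mult_mat_sum del: index_mult_mat(1))
qed (use U in auto)

section \<open>The automorphisms attached to the proalgebraic hull\<close>

lemma ZalgD:
  assumes "(\<gamma>, \<mu>) \<in> Zalg"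
  shows "x \<noteq> 0 \<Longrightarrow> \<gamma> x \<noteq> 0" "x \<noteq> 0 \<Longrightarrow> y \<noteq> 0 \<Longrightarrow> \<gamma> (x * y) = \<gamma> x * \<gamma> y" "\<gamma> 1 = 1"
proof -
  show 1: "x \<noteq> 0 \<Longrightarrow> \<gamma> x \<noteq> 0" for x
    using assms by (auto simp: Zalg_def Cstar_def hom_def)
  show 2: "x \<noteq> 0 \<Longrightarrow> y \<noteq> 0 \<Longrightarrow> \<gamma> (x * y) = \<gamma> x * \<gamma> y" for x y
    using assms by (auto simp: Zalg_def Cstar_def hom_def)
  show "\<gamma> 1 = 1"
    using 2[of 1 1] 1[of 1] by simp
qed

lemma Zalg_aut_dunford:
  assumes "A \<in> objects" "dunford A S U"
  shows "Zalg_aut (\<gamma>, \<mu>) A = map_eigenvalues \<gamma> S * unipotent_power U \<mu>"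
  using assms dunford_parts_eq[OF assms] by simp

lemma objects_carrier: "A \<in> objects \<Longrightarrow> A \<in> carrier_mat (dim_row A) (dim_row A)"
  by (auto simp: objects_def invertible_mat_def)

lemma kronecker_objects:
  assumes "A \<in> objects" "B \<in> objects"
  shows "kronecker A B \<in> objects"
proof -
  obtain n V where A: "A \<in> carrier_mat n n" "V \<in> carrier_mat n n" "A * V = 1\<^sub>m n" "V * A = 1\<^sub>m n"
    using objectsE[OF assms(1)] .
  obtain m W where B: "B \<in> carrier_mat m m" "W \<in> carrier_mat m m" "B * W = 1\<^sub>m m" "W * B = 1\<^sub>m m"
    using objectsE[OF assms(2)] .
  have "kronecker A B * kronecker V W = 1\<^sub>m (n * m)" "kronecker V W * kronecker A B = 1\<^sub>m (n * m)"
    using A B by (subst kronecker_mult; auto simp: kronecker_one)+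
  then show ?thesis
    using A(1,2) B(1,2) by (intro objectsI[of _ "n * m" "kronecker V W"]) (auto intro!: kronecker_carrier)
qed

lemma scalar_objects:
  assumes "c \<noteq> 0"
  shows "c \<cdot>\<^sub>m 1\<^sub>m n \<in> objects"
  by (rule objectsI[of _ n "(1 / c) \<cdot>\<^sub>m 1\<^sub>m n"])
    (use assms in \<open>auto simp: mult_smult_distrib[of _ n n _ n] mult_smult_assoc_mat[of _ n n _ n] intro!: eq_matI\<close>)

lemma Zalg_aut_scalar:
  assumes "c \<noteq> 0"
  shows "Zalg_aut (\<gamma>, \<mu>) (c \<cdot>\<^sub>m 1\<^sub>m n) = \<gamma> c \<cdot>\<^sub>m 1\<^sub>m n"
proof -
  have nil: "(1\<^sub>m n - 1\<^sub>m n :: complex mat) ^\<^sub>m 1 = 0\<^sub>m n n" by (intro eq_matI) auto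
  have diag: "c \<cdot>\<^sub>m 1\<^sub>m n = mat_diag n (\<lambda>_. c)"
    by (intro eq_matI) (auto simp: mat_diag_def)
  have "similar_mat_wit (c \<cdot>\<^sub>m 1\<^sub>m n) (mat_diag n (\<lambda>_. c)) (1\<^sub>m n) (1\<^sub>m n)"
    unfolding diag by (rule similar_mat_wit_refl[of _ n]) simp
  then have "dunford (c \<cdot>\<^sub>m 1\<^sub>m n) (c \<cdot>\<^sub>m 1\<^sub>m n) (1\<^sub>m n)"
    by (intro dunfordI[OF _ _ _ _ _ nil]) auto
  moreover have "unipotent_power (1\<^sub>m n) \<mu> = 1\<^sub>m n"
    by (intro eq_matI) (simp_all add: unipotent_power_index[OF one_carrier_mat nil])
  ultimately show ?thesis
    using Zalg_aut_dunford[OF scalar_objects[OF assms], of n] by (simp add: map_eigenvalues_scalar del: Zalg_aut.simps)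
qed

text \<open>Each clause transfers from the two factors: naturality since a morphism intertwines the Dunford
  parts separately, compatibility with tensor products since the Dunford decomposition of a Kronecker
  product is formed factor by factor.\<close>

lemma Zalg_aut_in_Aut_R:
  assumes \<gamma>: "(\<gamma>, \<mu>) \<in> Zalg"
  shows "Zalg_aut (\<gamma>, \<mu>) \<in> Aut_R"
proof -
  let ?\<psi> = "Zalg_aut (\<gamma>, \<mu>)"
  have carrier: "?\<psi> A \<in> carrier_mat (dim_row A) (dim_row A) \<and> invertible_mat (?\<psi> A)" if "A \<in> objects" for A
  proof -
    note mem = that
    obtain n where A: "A \<in> carrier_mat n n" using objects_carrier[OF mem] by blast
    obtain S U where dun: "dunford A S U" using dunford_exists[OF mem] by blast
    from dunfordE[OF this A] obtain c Q Q' k where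
      S: "S \<in> carrier_mat n n" "U \<in> carrier_mat n n"
      "similar_mat_wit S (mat_diag n c) Q Q'" "(U - 1\<^sub>m n) ^\<^sub>m k = 0\<^sub>m n n" by metis
    note Q = similar_mat_witD_carrier[OF S(3) mat_diag_dim]
    note [simp] = carrier_matD[OF Q(2)] carrier_matD[OF Q(3)] carrier_matD[OF S(2)] carrier_matD[OF mat_diag_dim]
    note cancel = mult_cancel_inverse[OF Q(5,3,2)]
    note nz = dunford_eigenvalues_nonzero[OF dun that A S(3)]
    let ?D = "\<lambda>d. Q * mat_diag n d * Q'"
    have D: "?D (\<gamma> \<circ> c) * ?D (\<lambda>i. 1 / \<gamma> (c i)) = 1\<^sub>m n" "?D (\<lambda>i. 1 / \<gamma> (c i)) * ?D (\<gamma> \<circ> c) = 1\<^sub>m n"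
    proof -
      have "mat_diag n (\<gamma> \<circ> c) * mat_diag n (\<lambda>i. 1 / \<gamma> (c i)) = mat_diag n (\<lambda>_. 1)"
        "mat_diag n (\<lambda>i. 1 / \<gamma> (c i)) * mat_diag n (\<gamma> \<circ> c) = mat_diag n (\<lambda>_. 1)"
        unfolding mat_diag_diag by (rule mat_diag_cong; simp add: nz ZalgD[OF \<gamma>])+
      moreover have "?D d * ?D e = Q * (mat_diag n d * mat_diag n e) * Q'" for d e :: "nat \<Rightarrow> complex"
        by (simp add: mat_mult_assoc cancel del: mat_diag_diag)
      ultimately show "?D (\<gamma> \<circ> c) * ?D (\<lambda>i. 1 / \<gamma> (c i)) = 1\<^sub>m n" "?D (\<lambda>i. 1 / \<gamma> (c i)) * ?D (\<gamma> \<circ> c) = 1\<^sub>m n"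
        using Q(2,4) by simp_all
    qed
    have \<psi>: "?\<psi> A = ?D (\<gamma> \<circ> c) * unipotent_power U \<mu>"
      using Zalg_aut_dunford[OF that dun, of \<gamma> \<mu>] map_eigenvalues_eq[OF S(3), of \<gamma>] by (simp del: Zalg_aut.simps)
    have V: "unipotent_power U \<mu> * unipotent_power U (- \<mu>) = 1\<^sub>m n" "unipotent_power U (- \<mu>) * unipotent_power U \<mu> = 1\<^sub>m n"
      using unipotent_power_uminus[OF S(2,4), of \<mu>] unipotent_power_uminus[OF S(2,4), of "- \<mu>"] by simp_all
    define X Y X' Y' where "X = ?D (\<gamma> \<circ> c)" "Y = unipotent_power U \<mu>" "X' = ?D (\<lambda>i. 1 / \<gamma> (c i))" "Y' = unipotent_power U (- \<mu>)"
    have XY: "X \<in> carrier_mat n n" "Y \<in> carrier_mat n n" "X' \<in> carrier_mat n n" "Y' \<in> carrier_mat n n"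
      "X * X' = 1\<^sub>m n" "X' * X = 1\<^sub>m n" "Y * Y' = 1\<^sub>m n" "Y' * Y = 1\<^sub>m n"
      using D V by (auto simp: X_Y_X'_Y'_def intro!: carrier_matI)
    have "X * Y \<in> objects"
    proof (rule objectsI)
      show "X * Y * (Y' * X') = 1\<^sub>m n" "Y' * X' * (X * Y) = 1\<^sub>m n"
        using mult_cancel_inverse[OF XY(7,2,4), of X'] mult_cancel_inverse[OF XY(6,3,1), of Y] XY
        by (simp_all add: mat_mult_assoc carrier_matD[OF XY(1)] carrier_matD[OF XY(2)]
            carrier_matD[OF XY(3)] carrier_matD[OF XY(4)])
    qed (use XY in auto)
    then show ?thesis
      using A XY(1,2) by (simp add: \<psi> objects_def X_Y_X'_Y'_def[symmetric] del: Zalg_aut.simps)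
  qed
  have natural: "F * ?\<psi> A = ?\<psi> B * F" if "A \<in> objects" "B \<in> objects" "F \<in> hom_R A B" for A B F
  proof -
    note mem = that
    obtain n where A: "A \<in> carrier_mat n n" using objects_carrier[OF mem(1)] by blast
    obtain m where B: "B \<in> carrier_mat m m" using objects_carrier[OF mem(2)] by blast
    have F: "F \<in> carrier_mat m n" "F * A = B * F"
      using that(3) A B by (auto simp: hom_R_def)
    obtain S U where SU: "dunford A S U" using dunford_exists[OF mem(1)] by blast
    obtain S' U' where SU': "dunford B S' U'" using dunford_exists[OF mem(2)] by blast
    from dunfordE[OF SU A] obtain c Q Q' k where
      S: "S \<in> carrier_mat n n" "U \<in> carrier_mat n n"
      "similar_mat_wit S (mat_diag n c) Q Q'" "(U - 1\<^sub>m n) ^\<^sub>m k = 0\<^sub>m n n" by metis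
    from dunfordE[OF SU' B] obtain d P P' l where
      S': "S' \<in> carrier_mat m m" "U' \<in> carrier_mat m m"
      "similar_mat_wit S' (mat_diag m d) P P'" "(U' - 1\<^sub>m m) ^\<^sub>m l = 0\<^sub>m m m" by metis
    note [simp] = carrier_matD[OF F(1)] carrier_matD[OF S(2)] carrier_matD[OF S'(2)]
    have 1: "F * map_eigenvalues \<gamma> S = map_eigenvalues \<gamma> S' * F"
      using S(1,3) S'(1,3) dunford_natural_ss[OF SU A SU' B F]
      by (intro map_eigenvalues_natural F) (auto simp: similar_mat_def)
    have 2: "F * unipotent_power U \<mu> = unipotent_power U' \<mu> * F"
      by (rule unipotent_power_natural[OF S(2,4) S'(2,4) F(1) dunford_natural_un[OF SU A SU' B that(2) F]])
    have [simp]: "dim_row (map_eigenvalues \<gamma> S) = n" "dim_col (map_eigenvalues \<gamma> S) = n"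
      "dim_row (map_eigenvalues \<gamma> S') = m" "dim_col (map_eigenvalues \<gamma> S') = m"
      using similar_mat_witD_carrier(2,3)[OF S(3) mat_diag_dim] similar_mat_witD_carrier(2,3)[OF S'(3) mat_diag_dim]
      by (auto simp: map_eigenvalues_eq[OF S(3)] map_eigenvalues_eq[OF S'(3)])
    have "F * (map_eigenvalues \<gamma> S * unipotent_power U \<mu>) = map_eigenvalues \<gamma> S' * F * unipotent_power U \<mu>"
      by (simp add: mat_mult_assoc flip: 1)
    also have "\<dots> = map_eigenvalues \<gamma> S' * unipotent_power U' \<mu> * F"
      by (simp add: mat_mult_assoc 2)
    finally show ?thesis
      by (simp only: Zalg_aut_dunford[OF that(1) SU] Zalg_aut_dunford[OF that(2) SU'])
  qed
  have tensor: "?\<psi> (kronecker A B) = kronecker (?\<psi> A) (?\<psi> B)" if "A \<in> objects" "B \<in> objects" for A B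
  proof -
    note mem = that
    obtain n where A: "A \<in> carrier_mat n n" using objects_carrier[OF mem(1)] by blast
    obtain m where B: "B \<in> carrier_mat m m" using objects_carrier[OF mem(2)] by blast
    obtain S U where SU: "dunford A S U" using dunford_exists[OF mem(1)] by blast
    obtain S' U' where SU': "dunford B S' U'" using dunford_exists[OF mem(2)] by blast
    from dunfordE[OF SU A] obtain c Q Q' k where
      S: "S \<in> carrier_mat n n" "U \<in> carrier_mat n n"
      "similar_mat_wit S (mat_diag n c) Q Q'" "(U - 1\<^sub>m n) ^\<^sub>m k = 0\<^sub>m n n" by metis
    from dunfordE[OF SU' B] obtain d P P' l where
      S': "S' \<in> carrier_mat m m" "U' \<in> carrier_mat m m"
      "similar_mat_wit S' (mat_diag m d) P P'" "(U' - 1\<^sub>m m) ^\<^sub>m l = 0\<^sub>m m m" by metis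
    note SSUU = dunford_kronecker[OF SU A SU' B]
    from dunfordE[OF SSUU kronecker_carrier[OF A B]] obtain r where
      r: "(kronecker U U' - 1\<^sub>m (n * m)) ^\<^sub>m r = 0\<^sub>m (n * m) (n * m)" by metis
    have [simp]: "dim_col (map_eigenvalues \<gamma> S) = n" "dim_col (map_eigenvalues \<gamma> S') = m"
      using similar_mat_witD_carrier(2,3)[OF S(3) mat_diag_dim] similar_mat_witD_carrier(2,3)[OF S'(3) mat_diag_dim]
      by (auto simp: map_eigenvalues_eq[OF S(3)] map_eigenvalues_eq[OF S'(3)])
    have 1: "map_eigenvalues \<gamma> (kronecker S S') = kronecker (map_eigenvalues \<gamma> S) (map_eigenvalues \<gamma> S')"
      by (rule map_eigenvalues_kronecker[OF S(3) S'(3)])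
        (simp add: ZalgD[OF \<gamma>] dunford_eigenvalues_nonzero[OF SU that(1) A S(3)]
          dunford_eigenvalues_nonzero[OF SU' that(2) B S'(3)])
    have 2: "unipotent_power (kronecker U U') \<mu> = kronecker (unipotent_power U \<mu>) (unipotent_power U' \<mu>)"
      by (rule unipotent_power_kronecker[OF S(2,4) S'(2,4) r])
    show ?thesis
      unfolding Zalg_aut_dunford[OF that(1) SU] Zalg_aut_dunford[OF that(2) SU']
        Zalg_aut_dunford[OF kronecker_objects[OF that] SSUU] 1 2
      by (rule kronecker_mult) (use S(2) S'(2) in simp_all)
  qed
  have unit: "?\<psi> (1\<^sub>m 1) = 1\<^sub>m 1"
  proof -
    have "1 \<cdot>\<^sub>m 1\<^sub>m 1 = (1\<^sub>m 1 :: complex mat)" by (intro eq_matI) auto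
    then show ?thesis
      using Zalg_aut_scalar[of 1 \<gamma> \<mu> 1] by (simp only: ZalgD(3)[OF \<gamma>]) simp
  qed
  have "?\<psi> \<in> extensional objects" by simp
  then show ?thesis
    unfolding Aut_R_def tensor_isos_def using carrier natural tensor unit by blast
qed

section \<open>The tensor automorphisms of the forgetful functor\<close>

lemma Aut_RD:
  assumes "\<phi> \<in> Aut_R"
  shows "A \<in> objects \<Longrightarrow> A \<in> carrier_mat n n \<Longrightarrow> \<phi> A \<in> carrier_mat n n"
    "A \<in> objects \<Longrightarrow> \<phi> A \<in> objects"
    "A \<in> objects \<Longrightarrow> B \<in> objects \<Longrightarrow> A \<in> carrier_mat n n \<Longrightarrow> B \<in> carrier_mat m m \<Longrightarrow>
      F \<in> carrier_mat m n \<Longrightarrow> F * A = B * F \<Longrightarrow> F * \<phi> A = \<phi> B * F"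
    "A \<in> objects \<Longrightarrow> B \<in> objects \<Longrightarrow> \<phi> (kronecker A B) = kronecker (\<phi> A) (\<phi> B)"
    "\<phi> (1\<^sub>m 1) = 1\<^sub>m 1"
    "\<phi> \<in> extensional objects"
proof -
  note * = assms[unfolded Aut_R_def tensor_isos_def mem_Collect_eq]
  show "A \<in> objects \<Longrightarrow> A \<in> carrier_mat n n \<Longrightarrow> \<phi> A \<in> carrier_mat n n"
    "A \<in> objects \<Longrightarrow> \<phi> A \<in> objects"
    "A \<in> objects \<Longrightarrow> B \<in> objects \<Longrightarrow> \<phi> (kronecker A B) = kronecker (\<phi> A) (\<phi> B)"
    "\<phi> (1\<^sub>m 1) = 1\<^sub>m 1" "\<phi> \<in> extensional objects"
    using * by (auto simp: objects_def)
  show "F * \<phi> A = \<phi> B * F" if "A \<in> objects" "B \<in> objects" "A \<in> carrier_mat n n" "B \<in> carrier_mat m m"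
    "F \<in> carrier_mat m n" "F * A = B * F"
  proof -
    have "F \<in> hom_R A B" using that by (auto simp: hom_R_def)
    with * that(1,2) show ?thesis by blast
  qed
qed

lemma sum_mult_jordan_block:
  assumes "i < m"
  shows "(\<Sum>a<m. g a * jordan_block m c $$ (a, i)) = g i * c + (if i = 0 then 0 else g (i - 1) :: complex)"
proof -
  have "(\<Sum>a<m. g a * jordan_block m c $$ (a, i))
      = (\<Sum>a<m. (if a = i then g a * c else 0) + (if Suc a = i then g a else 0))"
    using assms by (intro sum.cong) auto
  also have "\<dots> = g i * c + (\<Sum>a<m. if Suc a = i then g a else 0)"
    using assms by (simp add: sum.distrib)
  also have "(\<Sum>a<m. if Suc a = i then g a else 0) = (if i = 0 then 0 else g (i - 1))"
    using assms by (cases i) auto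
  finally show ?thesis .
qed

lemma sum_jordan_block_mult:
  assumes "r < m"
  shows "(\<Sum>a<m. jordan_block m c $$ (r, a) * g a) = c * g r + (if Suc r < m then g (Suc r) else 0 :: complex)"
proof -
  have "(\<Sum>a<m. jordan_block m c $$ (r, a) * g a)
      = (\<Sum>a<m. (if a = r then c * g a else 0) + (if a = Suc r then g a else 0))"
    using assms by (intro sum.cong) auto
  also have "\<dots> = c * g r + (if Suc r < m then g (Suc r) else 0)"
    using assms by (simp add: sum.distrib)
  finally show ?thesis .
qed

text \<open>For \<open>c \<noteq> 0\<close>, let the shift act on functions of an integer variable \<open>x\<close>. In the basis
  \<open>c ^ (x - i) * binomial x i\<close>, \<open>i < m\<close>, of a space stable under it, its matrix is the Jordan block of
  size \<open>m\<close> and eigenvalue \<open>c\<close>; for \<open>c = 1\<close>, \<open>m = 2\<close> the space consists of the polynomials of degree at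
  most \<open>1\<close>. The following matrix describes the multiplication map from the tensor product of the
  two spaces to the space of size \<open>m + 1\<close>; its entries come from \<open>x * binomial x i = (i + 1) * binomial x (i + 1) + i * binomial x i\<close>.\<close>

definition shift_mult :: "nat \<Rightarrow> complex \<Rightarrow> complex mat" where
  "shift_mult m c = mat (Suc m) (m * 2) (\<lambda>(r, s). let i = s div 2 in
     if even s then (if r = i then 1 else 0)
     else (if r = Suc i then c * of_nat (Suc i) else if r = i then of_nat i else 0))"

lemma shift_mult_index:
  assumes "r < Suc m" "i < m"
  shows "shift_mult m c $$ (r, i * 2) = (if r = i then 1 else 0)"
    "shift_mult m c $$ (r, Suc (i * 2)) = (if r = Suc i then c * of_nat (Suc i) else if r = i then of_nat i else 0)"
  using assms by (auto simp: shift_mult_def Let_def)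

lemma shift_mult_intertwines:
  "shift_mult m c * kronecker (jordan_block m c) (scaled_block 1) = jordan_block (Suc m) c * shift_mult m c"
proof (intro eq_matI)
  have [simp]: "dim_row (scaled_block 1) = 2" "dim_col (scaled_block 1) = 2"
    "dim_row (shift_mult m c) = Suc m" "dim_col (shift_mult m c) = m * 2"
    by (auto simp: scaled_block_def shift_mult_def)
  fix r s assume "r < dim_row (jordan_block (Suc m) c * shift_mult m c)"
    "s < dim_col (jordan_block (Suc m) c * shift_mult m c)"
  then have r: "r < Suc m" and s: "s < m * 2" by auto
  define i where "i = s div 2"
  have i: "i < m" using s by (auto simp: i_def)
  define f where "f r a = (if r = a then 1 else 0 :: complex)" for r a :: nat
  define g where "g r a = (if r = Suc a then c * of_nat (Suc a) else if r = a then of_nat a else 0)" for r a :: nat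
  note idx = shift_mult_index[of _ m _ c, folded f_def g_def]
  have L: "(shift_mult m c * kronecker (jordan_block m c) (scaled_block 1)) $$ (r, s)
    = (\<Sum>a<m. f r a * jordan_block m c $$ (a, i)) * scaled_block 1 $$ (0, s mod 2)
      + (\<Sum>a<m. g r a * jordan_block m c $$ (a, i)) * scaled_block 1 $$ (1, s mod 2)"
  proof -
    have "(shift_mult m c * kronecker (jordan_block m c) (scaled_block 1)) $$ (r, s)
      = (\<Sum>l<m * 2. shift_mult m c $$ (r, (l div 2) * 2 + l mod 2) *
          (jordan_block m c $$ (l div 2, i) * scaled_block 1 $$ (l mod 2, s mod 2)))"
      using r s by (subst index_mult_mat_sum) (auto simp: i_def intro!: sum.cong)
    also have "\<dots> = (\<Sum>a<m. \<Sum>b<2. shift_mult m c $$ (r, a * 2 + b) *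
          (jordan_block m c $$ (a, i) * scaled_block 1 $$ (b, s mod 2)))"
      by (rule sum_div_mod)
    also have "\<dots> = (\<Sum>a<m. f r a * jordan_block m c $$ (a, i) * scaled_block 1 $$ (0, s mod 2)
          + g r a * jordan_block m c $$ (a, i) * scaled_block 1 $$ (1, s mod 2))"
    proof (intro sum.cong refl)
      fix a assume "a \<in> {..<m}"
      moreover have "{..<2} = {0, 1 :: nat}" by auto
      ultimately show "(\<Sum>b<2. shift_mult m c $$ (r, a * 2 + b) * (jordan_block m c $$ (a, i) * scaled_block 1 $$ (b, s mod 2)))
        = f r a * jordan_block m c $$ (a, i) * scaled_block 1 $$ (0, s mod 2)
          + g r a * jordan_block m c $$ (a, i) * scaled_block 1 $$ (1, s mod 2)"
        using r by (simp add: idx)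
    qed
    finally show ?thesis by (simp add: sum.distrib sum_distrib_right)
  qed
  have R: "(jordan_block (Suc m) c * shift_mult m c) $$ (r, s)
      = c * shift_mult m c $$ (r, s) + (if Suc r < Suc m then shift_mult m c $$ (Suc r, s) else 0)"
    using r s by (subst index_mult_mat_sum) (auto simp only: sum_jordan_block_mult jordan_block_index(2,3)
        \<open>dim_row (shift_mult m c) = Suc m\<close> \<open>dim_col (shift_mult m c) = m * 2\<close>)
  show "(shift_mult m c * kronecker (jordan_block m c) (scaled_block 1)) $$ (r, s)
      = (jordan_block (Suc m) c * shift_mult m c) $$ (r, s)"
  proof (cases "even s")
    case True
    then have s_eq: "s = i * 2" by (simp add: i_def)
    show ?thesis
      unfolding L R sum_mult_jordan_block[OF i] unfolding s_eq using r i
      by (auto simp: idx scaled_block_def f_def)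
  next
    case False
    then have s_eq: "s = Suc (i * 2)" by (auto simp: i_def elim!: oddE)
    have 1: "s mod 2 = 1" using False by presburger
    have 2: "shift_mult m c $$ (r, s) = g r i" "Suc r < Suc m \<Longrightarrow> shift_mult m c $$ (Suc r, s) = g (Suc r) i"
      unfolding s_eq using r i by (simp_all only: idx)
    have 3: "scaled_block 1 $$ (0, 1) = 1" "scaled_block 1 $$ (1, 1) = 1"
      by (simp_all add: scaled_block_def)
    show ?thesis
      unfolding L R sum_mult_jordan_block[OF i] 1 3 using r i
      by (cases i; simp add: 2; simp add: f_def g_def algebra_simps)
  qed
qed (auto simp: shift_mult_def scaled_block_def)

text \<open>The objects on which two automorphisms agree are stable under tensor products, quotients and
  direct sums. The block of size \<open>m + 1\<close> and eigenvalue \<open>c\<close> is a quotient, through the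
  multiplication map above, of the block of size \<open>m\<close> tensored with the unipotent block of size \<open>2\<close>.
  So scalars and that unipotent block generate all objects.\<close>

lemma Aut_R_eqI:
  assumes \<phi>: "\<phi> \<in> Aut_R" and \<psi>: "\<psi> \<in> Aut_R"
    and scalar: "\<And>c. c \<noteq> 0 \<Longrightarrow> \<phi> (c \<cdot>\<^sub>m 1\<^sub>m 1) = \<psi> (c \<cdot>\<^sub>m 1\<^sub>m 1)"
    and unipotent: "\<phi> (scaled_block 1) = \<psi> (scaled_block 1)"
  shows "\<phi> = \<psi>"
proof (rule extensionalityI[of _ objects])
  have transport: "\<phi> B * F = \<psi> B * F"
    if "\<phi> A = \<psi> A" "A \<in> objects" "B \<in> objects" "A \<in> carrier_mat n n" "B \<in> carrier_mat m m"
      "F \<in> carrier_mat m n" "F * A = B * F" for A B F n m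
    using Aut_RD(3)[OF \<phi> that(2-7)] Aut_RD(3)[OF \<psi> that(2-7)] that(1) by simp
  have block: "\<phi> (jordan_block m c) = \<psi> (jordan_block m c)" if "c \<noteq> 0" for m c
  proof (induction m)
    case 0
    show ?case
      using Aut_RD(1)[OF \<phi> jordan_block_objects[OF that] jordan_block_carrier, of 0]
        Aut_RD(1)[OF \<psi> jordan_block_objects[OF that] jordan_block_carrier, of 0]
      by (intro eq_matI) auto
  next
    case (Suc m)
    show ?case
    proof (cases "m = 0")
      case True
      have "jordan_block 1 c = c \<cdot>\<^sub>m 1\<^sub>m 1" by (intro eq_matI) auto
      then show ?thesis using scalar[OF that] True by simp
    next
      case False
      let ?A = "kronecker (jordan_block m c) (scaled_block 1)" and ?B = "jordan_block (Suc m) c"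
      have J2: "scaled_block 1 \<in> carrier_mat 2 2" "scaled_block 1 \<in> objects"
        using scaled_block_in_objects[of 1] by (auto simp: scaled_block_def)
      have F: "shift_mult m c \<in> carrier_mat (Suc m) (m * 2)" by (simp add: shift_mult_def)
      have "\<phi> ?A = \<psi> ?A"
        using Suc unipotent J2 by (simp add: Aut_RD(4)[OF \<phi>] Aut_RD(4)[OF \<psi>] jordan_block_objects[OF that])
      then have eq: "\<phi> ?B * shift_mult m c = \<psi> ?B * shift_mult m c"
        by (rule transport) (use J2 F that in \<open>auto intro!: kronecker_objects jordan_block_objects kronecker_carrier
            simp: shift_mult_intertwines\<close>)
      have carr: "\<phi> ?B \<in> carrier_mat (Suc m) (Suc m)" "\<psi> ?B \<in> carrier_mat (Suc m) (Suc m)"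
        using Aut_RD(1)[OF \<phi> jordan_block_objects[OF that] jordan_block_carrier]
          Aut_RD(1)[OF \<psi> jordan_block_objects[OF that] jordan_block_carrier] by auto
      have col_even: "(X * shift_mult m c) $$ (k, i * 2) = X $$ (k, i)"
        if "X \<in> carrier_mat (Suc m) (Suc m)" "k < Suc m" "i < m" for X k i
      proof -
        have "(X * shift_mult m c) $$ (k, i * 2) = (\<Sum>r<Suc m. X $$ (k, r) * shift_mult m c $$ (r, i * 2))"
          using that F by (subst index_mult_mat_sum) auto
        also have "\<dots> = (\<Sum>r<Suc m. if r = i then X $$ (k, r) else 0)"
          using that by (intro sum.cong) (auto simp: shift_mult_index)
        finally have "(X * shift_mult m c) $$ (k, i * 2) = (\<Sum>r<Suc m. if r = i then X $$ (k, r) else 0)" .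
        then show ?thesis using that by simp
      qed
      have col_odd: "(X * shift_mult m c) $$ (k, Suc (i * 2))
          = X $$ (k, Suc i) * (c * of_nat (Suc i)) + X $$ (k, i) * of_nat i"
        if "X \<in> carrier_mat (Suc m) (Suc m)" "k < Suc m" "i < m" for X k i
      proof -
        have "(X * shift_mult m c) $$ (k, Suc (i * 2)) = (\<Sum>r<Suc m. X $$ (k, r) * shift_mult m c $$ (r, Suc (i * 2)))"
          using that F by (subst index_mult_mat_sum) auto
        also have "\<dots> = (\<Sum>r<Suc m. (if r = Suc i then X $$ (k, r) * (c * of_nat (Suc i)) else 0)
              + (if r = i then X $$ (k, r) * of_nat i else 0))"
          using that by (intro sum.cong) (auto simp: shift_mult_index)
        finally show ?thesis using that by (simp add: sum.distrib del: of_nat_Suc sum.lessThan_Suc)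
      qed
      have first: "\<phi> ?B $$ (k, i) = \<psi> ?B $$ (k, i)" if "k < Suc m" "i < m" for k i
        using col_even[OF carr(1) that] col_even[OF carr(2) that] by (simp add: eq del: index_mult_mat(1))
      show ?thesis
      proof (intro eq_matI)
        fix k i assume "k < dim_row (\<psi> ?B)" "i < dim_col (\<psi> ?B)"
        then have ki: "k < Suc m" "i < Suc m" using carr by auto
        show "\<phi> ?B $$ (k, i) = \<psi> ?B $$ (k, i)"
        proof (cases "i < m")
          case False
          \<comment> \<open>the last column is reached from \<open>x * binomial x (m - 1)\<close>, up to the nonzero factor \<open>c m\<close>\<close>
          then have i: "i = Suc (m - 1)" using ki \<open>m \<noteq> 0\<close> by simp
          have m1: "m - 1 < m" using \<open>m \<noteq> 0\<close> by simp
          have "(\<phi> ?B * shift_mult m c) $$ (k, Suc ((m - 1) * 2)) = (\<psi> ?B * shift_mult m c) $$ (k, Suc ((m - 1) * 2))"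
            by (simp only: eq)
          then have "\<phi> ?B $$ (k, i) * (c * of_nat i) = \<psi> ?B $$ (k, i) * (c * of_nat i)"
            unfolding col_odd[OF carr(1) ki(1) m1] col_odd[OF carr(2) ki(1) m1] first[OF ki(1) m1] i[symmetric]
            by simp
          moreover have "c * of_nat i \<noteq> 0" using that False \<open>m \<noteq> 0\<close> by simp
          ultimately show ?thesis by simp
        qed (use first ki in auto)
      qed (use carr in auto)
    qed
  qed
  fix A assume "A \<in> objects"
  then show "\<phi> A = \<psi> A"
  proof (induction rule: objects_induct)
    case (direct_sum n m A B)
    let ?C = "four_block_mat A (0\<^sub>m n m) (0\<^sub>m m n) B"
    have C: "?C \<in> carrier_mat (n + m) (n + m)" "?C \<in> objects"
    proof -
      show C1: "?C \<in> carrier_mat (n + m) (n + m)" using direct_sum by auto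
      have "det ?C = det A * det B"
        by (rule det_four_block_mat_lower_left_zero[of _ n _ m]) (use direct_sum in auto)
      then show "?C \<in> objects"
        using direct_sum by (simp add: objects_iff_det[OF C1] objects_iff_det[of A n] objects_iff_det[of B m])
    qed
    have carr: "\<phi> ?C \<in> carrier_mat (n + m) (n + m)" "\<psi> ?C \<in> carrier_mat (n + m) (n + m)"
      using Aut_RD(1)[OF \<phi> C(2,1)] Aut_RD(1)[OF \<psi> C(2,1)] by auto
    \<comment> \<open>\<open>E n 0\<close> and \<open>E m n\<close> are the inclusions of the two summands, which are jointly surjective\<close>
    define E where "E p k = mat (n + m) p (\<lambda>(i, j). if i = j + k then 1 else 0 :: complex)" for p k
    have E: "E p k \<in> carrier_mat (n + m) p" for p k by (simp add: E_def)
    have XE: "(X * E p k) $$ (i, j) = X $$ (i, j + k)"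
      if "X \<in> carrier_mat (n + m) (n + m)" "i < n + m" "j < p" "p + k \<le> n + m" for X p k i j
    proof -
      have "(X * E p k) $$ (i, j) = (\<Sum>r<n + m. X $$ (i, r) * E p k $$ (r, j))"
        using that E[of p k] by (subst index_mult_mat_sum) auto
      also have "\<dots> = (\<Sum>r<n + m. if r = j + k then X $$ (i, r) else 0)"
        using that by (intro sum.cong) (auto simp: E_def)
      finally show ?thesis using that by simp
    qed
    have EX: "(E p k * X) $$ (i, j) = (if k \<le> i \<and> i < p + k then X $$ (i - k, j) else 0)"
      if "X \<in> carrier_mat p p" "i < n + m" "j < p" for X p k i j
    proof -
      have "(E p k * X) $$ (i, j) = (\<Sum>r<p. E p k $$ (i, r) * X $$ (r, j))"
        using that E[of p k] by (subst index_mult_mat_sum) auto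
      also have "\<dots> = (\<Sum>r<p. if r = i - k then if k \<le> i then X $$ (r, j) else 0 else 0)"
        using that by (intro sum.cong) (auto simp: E_def)
      finally show ?thesis using that by auto
    qed
    have "E n 0 * A = ?C * E n 0"
      using direct_sum(2,4) E[of n 0]
      by (intro eq_matI) (auto simp: XE[OF C(1)] EX[OF direct_sum(2)] simp del: index_mult_mat(1))
    from transport[OF direct_sum(5,1) C(2) direct_sum(2) C(1) E this]
    have 1: "\<phi> ?C * E n 0 = \<psi> ?C * E n 0" .
    have "E m n * B = ?C * E m n"
      using direct_sum(2,4) E[of m n]
      by (intro eq_matI) (auto simp: XE[OF C(1)] EX[OF direct_sum(4)] simp del: index_mult_mat(1))
    from transport[OF direct_sum(6,3) C(2) direct_sum(4) C(1) E this]
    have 2: "\<phi> ?C * E m n = \<psi> ?C * E m n" .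
    show ?case
    proof (intro eq_matI)
      fix i j assume "i < dim_row (\<psi> ?C)" "j < dim_col (\<psi> ?C)"
      then have ij: "i < n + m" "j < n + m" using carr by auto
      show "\<phi> ?C $$ (i, j) = \<psi> ?C $$ (i, j)"
      proof (cases "j < n")
        case True
        then show ?thesis
          using XE[OF carr(1) ij(1), of j n 0] XE[OF carr(2) ij(1), of j n 0] 1 by simp
      next
        case False
        then show ?thesis
          using XE[OF carr(1) ij(1), of "j - n" m n] XE[OF carr(2) ij(1), of "j - n" m n] 2 ij by simp
      qed
    qed (use carr in auto)
  next
    case (similar A B Q Q')
    obtain n where B: "B \<in> carrier_mat n n" using objects_carrier[OF similar(2)] by blast
    note Q = similar_mat_witD_carrier[OF similar(3) B]
    have carr: "\<phi> A \<in> carrier_mat n n" "\<psi> A \<in> carrier_mat n n"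
      using Aut_RD(1)[OF \<phi> similar(1) Q(1)] Aut_RD(1)[OF \<psi> similar(1) Q(1)] by auto
    have "Q * B = A * Q"
      using Q(2,3,5) B by (simp add: Q(6) mat_mult_assoc)
    from transport[OF similar(4,2,1) B Q(1,2) this]
    have "\<phi> A * Q * Q' = \<psi> A * Q * Q'" by (simp only:)
    then have "\<phi> A * (Q * Q') = \<psi> A * (Q * Q')"
      using assoc_mult_mat[OF carr(1) Q(2,3)] assoc_mult_mat[OF carr(2) Q(2,3)] by simp
    then show ?case using carr by (simp add: Q(4))
  qed (use block in blast)
qed (use Aut_RD(6)[OF \<phi>] Aut_RD(6)[OF \<psi>] in auto)

lemma smult_smult_mat: "a \<cdot>\<^sub>m (b \<cdot>\<^sub>m M) = (a * b :: 'a :: semigroup_mult) \<cdot>\<^sub>m M"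
  by (intro eq_matI) (auto simp: mult.assoc)

text \<open>The pair attached to an automorphism is read off from the scalars, giving \<open>\<gamma>\<close>, and from the
  unipotent block \<open>J\<close> of size \<open>2\<close>, giving \<open>\<mu>\<close>. The value at \<open>J\<close> commutes with \<open>J\<close> and fixes the
  invariant vector of \<open>J\<close>, so that it is unipotent and upper triangular.\<close>

lemma Aut_R_eq: "Aut_R = Zalg_aut ` Zalg"
proof (intro equalityI subsetI)
  fix \<phi> assume \<phi>: "\<phi> \<in> Aut_R"
  let ?J = "scaled_block 1"
  have J: "?J \<in> carrier_mat 2 2" "?J \<in> objects"
    using scaled_block_in_objects[of 1] by (auto simp: scaled_block_def)
  have one: "1\<^sub>m 1 \<in> objects" 
  proof -
    have "1 \<cdot>\<^sub>m 1\<^sub>m 1 = (1\<^sub>m 1 :: complex mat)" by (intro eq_matI) auto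
    then show ?thesis using scalar_objects[of 1 1] by simp
  qed
  define \<gamma> where "\<gamma> = restrict (\<lambda>c. \<phi> (c \<cdot>\<^sub>m 1\<^sub>m 1) $$ (0, 0)) (carrier Cstar)"
  define \<mu> where "\<mu> = \<phi> ?J $$ (0, 1)"
  have carr1: "\<phi> (c \<cdot>\<^sub>m 1\<^sub>m 1) \<in> carrier_mat 1 1" if "c \<noteq> 0" for c
    by (rule Aut_RD(1)[OF \<phi> scalar_objects[OF that]]) simp
  have \<phi>_scalar: "\<phi> (c \<cdot>\<^sub>m 1\<^sub>m 1) = \<gamma> c \<cdot>\<^sub>m 1\<^sub>m 1" if "c \<noteq> 0" for c
    using carr1[OF that] that by (intro eq_matI) (auto simp: \<gamma>_def Cstar_def)
  have \<gamma>_nz: "\<gamma> c \<noteq> 0" if "c \<noteq> 0" for c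
  proof
    assume "\<gamma> c = 0"
    then have "\<phi> (c \<cdot>\<^sub>m 1\<^sub>m 1) = 0 \<cdot>\<^sub>m 1\<^sub>m 1" by (simp only: \<phi>_scalar[OF that])
    also have "\<dots> = 0\<^sub>m 1 1" by (intro eq_matI) auto
    finally have "\<phi> (c \<cdot>\<^sub>m 1\<^sub>m 1) = 0\<^sub>m 1 1" .
    moreover have "det (\<phi> (c \<cdot>\<^sub>m 1\<^sub>m 1)) \<noteq> 0"
      using Aut_RD(2)[OF \<phi> scalar_objects[OF that]] objects_iff_det[OF carr1[OF that]] by simp
    ultimately show False by simp
  qed
  have \<gamma>_mult: "\<gamma> (c * d) = \<gamma> c * \<gamma> d" if "c \<noteq> 0" "d \<noteq> 0" for c d
  proof -
    have "\<phi> (kronecker (c \<cdot>\<^sub>m 1\<^sub>m 1) (d \<cdot>\<^sub>m 1\<^sub>m 1)) = kronecker (\<phi> (c \<cdot>\<^sub>m 1\<^sub>m 1)) (\<phi> (d \<cdot>\<^sub>m 1\<^sub>m 1))"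
      by (intro Aut_RD(4)[OF \<phi>] scalar_objects that)
    then have "\<phi> ((c * d) \<cdot>\<^sub>m 1\<^sub>m 1) = (\<gamma> c * \<gamma> d) \<cdot>\<^sub>m 1\<^sub>m 1"
      by (simp only: \<phi>_scalar[OF that(1)] \<phi>_scalar[OF that(2)] kronecker_scalar smult_smult_mat)
    moreover have "\<phi> ((c * d) \<cdot>\<^sub>m 1\<^sub>m 1) = \<gamma> (c * d) \<cdot>\<^sub>m 1\<^sub>m 1"
      by (rule \<phi>_scalar) (use that in simp)
    ultimately have "\<gamma> (c * d) \<cdot>\<^sub>m 1\<^sub>m 1 = (\<gamma> c * \<gamma> d) \<cdot>\<^sub>m (1\<^sub>m 1 :: complex mat)"
      by (simp only:)
    from arg_cong[OF this, of "\<lambda>M. M $$ (0, 0)"] show ?thesis by simp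
  qed
  have Z: "(\<gamma>, \<mu>) \<in> Zalg"
    using \<gamma>_nz \<gamma>_mult by (auto simp: Zalg_def hom_def Cstar_def) (simp add: \<gamma>_def Cstar_def)
  have \<psi>: "Zalg_aut (\<gamma>, \<mu>) \<in> Aut_R" by (rule Zalg_aut_in_Aut_R[OF Z])
  have J_form: "\<theta> ?J \<in> carrier_mat 2 2" "\<theta> ?J $$ (1, 0) = 0" "\<theta> ?J $$ (1, 1) = 1" "\<theta> ?J $$ (0, 0) = 1"
    if \<theta>: "\<theta> \<in> Aut_R" for \<theta>
  proof -
    show c: "\<theta> ?J \<in> carrier_mat 2 2" by (rule Aut_RD(1)[OF \<theta> J(2,1)])
    have "?J * \<theta> ?J = \<theta> ?J * ?J"
      by (rule Aut_RD(3)[OF \<theta> J(2,2,1,1,1) refl])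
    note comm = commute_scaled_block[OF c this[symmetric]]
    \<comment> \<open>the invariant vector of \<open>J\<close>, as a morphism from the unit object\<close>
    define e where "e = mat 2 1 (\<lambda>(i, j). if i = 0 then 1 else 0 :: complex)"
    have e: "e \<in> carrier_mat 2 1" by (simp add: e_def)
    have col: "(X * e) $$ (0, 0) = X $$ (0, 0)" if "X \<in> carrier_mat 2 2" for X
      using that e by (subst index_mult_mat_sum) (auto simp: e_def numeral_2_eq_2)
    have "e * 1\<^sub>m 1 = ?J * e"
      using J(1) e by (intro eq_matI) (auto simp: e_def scaled_block_def scalar_prod_def numeral_2_eq_2 less_Suc_eq)
    from Aut_RD(3)[OF \<theta> one J(2) one_carrier_mat J(1) e this]
    have "e = \<theta> ?J * e" by (simp only: Aut_RD(5)[OF \<theta>] right_mult_one_mat[OF e])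
    from arg_cong[OF this, of "\<lambda>M. M $$ (0, 0)"] have "\<theta> ?J $$ (0, 0) = 1"
      unfolding col[OF c] by (simp add: e_def)
    then show "\<theta> ?J $$ (1, 0) = 0" "\<theta> ?J $$ (1, 1) = 1" "\<theta> ?J $$ (0, 0) = 1"
      using comm by simp_all
  qed
  have "Zalg_aut (\<gamma>, \<mu>) = \<phi>"
  proof (rule Aut_R_eqI[OF \<psi> \<phi>])
    fix c :: complex assume c: "c \<noteq> 0"
    show "Zalg_aut (\<gamma>, \<mu>) (c \<cdot>\<^sub>m 1\<^sub>m 1) = \<phi> (c \<cdot>\<^sub>m 1\<^sub>m 1)"
      by (simp only: Zalg_aut_scalar[OF c] \<phi>_scalar[OF c])
  next
    have "Zalg_aut (\<gamma>, \<mu>) ?J $$ (0, 1) = \<phi> ?J $$ (0, 1)"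
      using Zalg_aut_scaled_block(2)[of 1 \<gamma> \<mu>] ZalgD(3)[OF Z] by (simp add: \<mu>_def del: Zalg_aut.simps)
    then show "Zalg_aut (\<gamma>, \<mu>) ?J = \<phi> ?J"
      using J_form[OF \<phi>] J_form[OF \<psi>] by (intro eq_matI) (auto simp: lt_2_iff simp del: Zalg_aut.simps)
  qed
  with Z show "\<phi> \<in> Zalg_aut ` Zalg" by blast
next
  fix \<phi> assume "\<phi> \<in> Zalg_aut ` Zalg"
  then show "\<phi> \<in> Aut_R" using Zalg_aut_in_Aut_R by auto
qed

section \<open>Morphisms with Laurent polynomial entries\<close>

lemma fls_nth_sigma:
  assumes "q \<noteq> 0"
  shows "fls_nth (sigma q f) k = fls_nth f k * q powi k"
  unfolding sigma_def using assms by (rule fls_nth_fls_compose_fps_linear)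

lemma eval_fls_finite_support:
  assumes "z \<noteq> 0" "finite K" "\<And>k. k \<notin> K \<Longrightarrow> fls_nth f k = 0"
  shows "eval_fls f z = (\<Sum>k\<in>K. fls_nth f k * z powi k)"
proof -
  define N where "N = Min (insert (fls_subdegree f) K)"
  have N: "N \<le> fls_subdegree f" "k \<in> K \<Longrightarrow> N \<le> k" for k
    using assms(2) by (auto simp: N_def)
  have "(\<lambda>n. fls_nth f (int n + N) * z powi (int n + N)) sums
      (\<Sum>n\<in>(\<lambda>k. nat (k - N)) ` K. fls_nth f (int n + N) * z powi (int n + N))"
  proof (rule sums_finite)
    fix n assume n: "n \<notin> (\<lambda>k. nat (k - N)) ` K"
    have "int n + N \<notin> K"
    proof
      assume "int n + N \<in> K"
      from imageI[OF this, of "\<lambda>k. nat (k - N)"] n show False by simp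
    qed
    then show "fls_nth f (int n + N) * z powi (int n + N) = 0" by (simp add: assms(3))
  qed (use assms(2) in simp)
  also have "(\<Sum>n\<in>(\<lambda>k. nat (k - N)) ` K. fls_nth f (int n + N) * z powi (int n + N))
      = (\<Sum>k\<in>K. fls_nth f k * z powi k)"
  proof (subst sum.reindex)
    show "inj_on (\<lambda>k. nat (k - N)) K"
    proof (rule inj_onI)
      fix k l assume "k \<in> K" "l \<in> K" "nat (k - N) = nat (l - N)"
      with N(2)[of k] N(2)[of l] show "k = l" by simp
    qed
  qed (use N(2) in simp)
  finally show ?thesis
    by (intro eval_fls_eq[OF N(1)]) (use assms(1) in auto)
qed

text \<open>Comparing coefficients of \<open>z ^ k\<close> in \<open>F (q z) A = B F (z)\<close>.\<close>

lemma hom_P0_coeff: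
  assumes q: "q \<noteq> 0" and A: "A \<in> carrier_mat n n" and B: "B \<in> carrier_mat m m" and F: "F \<in> hom_P0 q A B"
  shows "map_mat (\<lambda>f. fls_nth f k) F \<in> carrier_mat m n"
    "map_mat (\<lambda>f. fls_nth f k) F * (q powi k \<cdot>\<^sub>m A) = B * map_mat (\<lambda>f. fls_nth f k) F"
proof -
  have F1: "F \<in> carrier_mat m n" "map_mat (sigma q) F * map_mat fls_const A = map_mat fls_const B * F"
    using F A B by (auto simp: hom_P0_def)
  note [simp] = carrier_matD[OF F1(1)] carrier_matD[OF A] carrier_matD[OF B]
  show "map_mat (\<lambda>f. fls_nth f k) F \<in> carrier_mat m n" by (intro carrier_matI) auto
  show "map_mat (\<lambda>f. fls_nth f k) F * (q powi k \<cdot>\<^sub>m A) = B * map_mat (\<lambda>f. fls_nth f k) F"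
  proof (intro eq_matI)
    fix i j assume "i < dim_row (B * map_mat (\<lambda>f. fls_nth f k) F)" "j < dim_col (B * map_mat (\<lambda>f. fls_nth f k) F)"
    then have ij: "i < m" "j < n" by auto
    have "fls_nth ((map_mat (sigma q) F * map_mat fls_const A) $$ (i, j)) k
        = fls_nth ((map_mat fls_const B * F) $$ (i, j)) k"
      by (simp only: F1(2))
    then have "(\<Sum>l<n. fls_nth (F $$ (i, l)) k * q powi k * A $$ (l, j)) = (\<Sum>l<m. B $$ (i, l) * fls_nth (F $$ (l, j)) k)"
      using ij by (simp add: index_mult_mat_sum fls_nth_sum fls_nth_sigma[OF q] del: index_mult_mat(1))
    then show "(map_mat (\<lambda>f. fls_nth f k) F * (q powi k \<cdot>\<^sub>m A)) $$ (i, j) = (B * map_mat (\<lambda>f. fls_nth f k) F) $$ (i, j)"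
      using ij by (simp add: index_mult_mat_sum mult_ac del: index_mult_mat(1))
  qed auto
qed

lemma dunford_smult:
  assumes "x \<noteq> 0" "dunford A S U" "A \<in> carrier_mat n n"
  shows "dunford (x \<cdot>\<^sub>m A) (x \<cdot>\<^sub>m S) U"
proof -
  from dunfordE[OF assms(2,3)] obtain c Q Q' k where
    S: "S \<in> carrier_mat n n" "U \<in> carrier_mat n n" "A = S * U" "S * U = U * S"
    "similar_mat_wit S (mat_diag n c) Q Q'" "(U - 1\<^sub>m n) ^\<^sub>m k = 0\<^sub>m n n" by metis
  have "x \<cdot>\<^sub>m mat_diag n c = mat_diag n (\<lambda>i. x * c i)"
    by (intro eq_matI) (auto simp: mat_diag_def)
  with similar_mat_wit_smult[OF S(5), of x]
  have sim: "similar_mat_wit (x \<cdot>\<^sub>m S) (mat_diag n (\<lambda>i. x * c i)) Q Q'" by simp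
  show ?thesis
    by (rule dunfordI[OF _ _ _ _ sim S(6)])
      (use S(1-4) in \<open>simp_all add: mult_smult_distrib[of _ n n _ n] mult_smult_assoc_mat[of _ n n _ n]\<close>)
qed

lemma powi_inj:
  fixes q :: complex
  assumes "cmod q > 1" "q powi k = q powi l"
  shows "k = l"
proof -
  have "cmod q powi k = cmod q powi l"
    using arg_cong[OF assms(2), of cmod] by (simp add: norm_power_int)
  then show ?thesis
    using assms(1) power_int_strict_increasing[of k l "cmod q"] power_int_strict_increasing[of l k "cmod q"]
    by (cases k l rule: linorder_cases) auto
qed

text \<open>If the coefficient of \<open>z ^ k\<close> of a morphism is nonzero, then \<open>q ^ k\<close> is a quotient of an
  eigenvalue of \<open>B\<close> by one of \<open>A\<close>. Since \<open>q\<close> is not a root of unity, this leaves finitely many \<open>k\<close>.\<close>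

lemma hom_P0_finite:
  assumes q: "cmod q > 1" and A: "A \<in> objects" "A \<in> carrier_mat n n"
    and B: "B \<in> objects" "B \<in> carrier_mat m m" and F: "F \<in> hom_P0 q A B"
  shows "finite {k. map_mat (\<lambda>f. fls_nth f k) F \<noteq> 0\<^sub>m m n}"
proof -
  have q0: "q \<noteq> 0" using q by auto
  obtain S U where SU: "dunford A S U" using dunford_exists[OF A(1)] by blast
  obtain S' U' where SU': "dunford B S' U'" using dunford_exists[OF B(1)] by blast
  from dunfordE[OF SU A(2)] obtain c Q Q' where S: "S \<in> carrier_mat n n" "similar_mat_wit S (mat_diag n c) Q Q'" by metis
  from dunfordE[OF SU' B(2)] obtain d P P' where S': "S' \<in> carrier_mat m m" "similar_mat_wit S' (mat_diag m d) P P'" by metis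
  note Q = similar_mat_witD_carrier[OF S(2) mat_diag_dim]
  note P = similar_mat_witD_carrier[OF S'(2) mat_diag_dim]
  have "{k. map_mat (\<lambda>f. fls_nth f k) F \<noteq> 0\<^sub>m m n} \<subseteq> (\<Union>(i, j)\<in>{..<m} \<times> {..<n}. {k. q powi k = d i / c j})"
  proof
    fix k assume k: "k \<in> {k. map_mat (\<lambda>f. fls_nth f k) F \<noteq> 0\<^sub>m m n}"
    define X where "X = map_mat (\<lambda>f. fls_nth f k) F"
    note X = hom_P0_coeff[OF q0 A(2) B(2) F, of k, folded X_def]
    have qA: "dunford (q powi k \<cdot>\<^sub>m A) (q powi k \<cdot>\<^sub>m S) U" "q powi k \<cdot>\<^sub>m A \<in> carrier_mat n n"
      using dunford_smult[OF _ SU A(2), of "q powi k"] q0 A(2) by auto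
    have "q powi k \<cdot>\<^sub>m mat_diag n c = mat_diag n (\<lambda>i. q powi k * c i)"
      by (intro eq_matI) (auto simp: mat_diag_def)
    with similar_mat_wit_smult[OF S(2), of "q powi k"]
    have sim: "similar_mat_wit (q powi k \<cdot>\<^sub>m S) (mat_diag n (\<lambda>i. q powi k * c i)) Q Q'" by simp
    have G: "(P' * X * Q) $$ (i, j) * (q powi k * c j) = d i * (P' * X * Q) $$ (i, j)" if "i < m" "j < n" for i j
      using dunford_natural_ss[OF qA SU' B(2) X] that
      unfolding intertwine_diagonalisable_iff[OF sim S'(2) X(1)] by blast
    have "P' * X * Q \<noteq> 0\<^sub>m m n"
    proof
      assume "P' * X * Q = 0\<^sub>m m n"
      then have "P * (P' * X * Q) * Q' = 0\<^sub>m m n" using P(2) Q(3) by simp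
      moreover have "P * (P' * X * Q) * Q' = X"
        using P(2,3) Q(2-4) X(1)
        by (simp add: mat_mult_assoc mult_cancel_inverse[OF P(4,2,3)] carrier_matD[OF P(2)] carrier_matD[OF P(3)])
      ultimately show False using k by (simp add: X_def)
    qed
    then obtain i j where ij: "i < m" "j < n" "(P' * X * Q) $$ (i, j) \<noteq> 0"
      using P(3) Q(2) by (auto simp: mat_eq_iff simp del: index_mult_mat(1))
    then have "q powi k * c j = d i" using G[of i j] by (simp add: mult.commute del: index_mult_mat(1))
    then have "q powi k = d i / c j"
      using dunford_eigenvalues_nonzero[OF SU A S(2) ij(2)] by (simp add: field_simps)
    with ij show "k \<in> (\<Union>(i, j)\<in>{..<m} \<times> {..<n}. {k. q powi k = d i / c j})" by auto
  qed
  moreover have "finite {k. q powi k = x}" for x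
  proof (cases "\<exists>l. q powi l = x")
    case True
    then obtain l where l: "q powi l = x" by blast
    have "{k. q powi k = x} \<subseteq> {l}"
    proof
      fix k assume "k \<in> {k. q powi k = x}"
      then show "k \<in> {l}" using powi_inj[OF q, of k l] by (simp add: l)
    qed
    then show ?thesis by (rule finite_subset) simp
  qed simp
  ultimately show ?thesis by (auto elim!: finite_subset)
qed

lemma ZalgD_powi:
  assumes "(\<gamma>, \<mu>) \<in> Zalg" "x \<noteq> 0"
  shows "\<gamma> (x powi k) = \<gamma> x powi k"
proof -
  have nat: "\<gamma> (y ^ n) = \<gamma> y ^ n" if "y \<noteq> 0" for y n
    using that by (induction n) (auto simp: ZalgD[OF assms(1)])
  have "\<gamma> x * \<gamma> (inverse x) = 1"
    using ZalgD(2)[OF assms(1), of x "inverse x"] assms(2) by (simp add: ZalgD(3)[OF assms(1)])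
  then have "\<gamma> (inverse x) = inverse (\<gamma> x)"
    using ZalgD(1)[OF assms] by (simp add: field_simps)
  then show ?thesis
    using nat[of x] nat[of "inverse x"] assms(2) by (simp add: power_int_def)
qed

text \<open>A morphism \<open>F\<close> is a finite sum of terms \<open>F\<^sub>k z ^ k\<close> where \<open>F\<^sub>k\<close> is a constant morphism from
  \<open>q ^ k A\<close> to \<open>B\<close>, and \<open>q ^ k A\<close> is the tensor product of \<open>A\<close> with a character. Writing
  \<open>\<phi>\<close> for the automorphism, this gives \<open>(\<gamma> q) ^ k F\<^sub>k \<phi>(A) = \<phi>(B) F\<^sub>k\<close>, and the factor \<open>(\<gamma> q) ^ k\<close> is what turns \<open>z0 ^ k\<close> into \<open>z1 ^ k\<close>.\<close>

lemma Zalg_aut_in_Iso_P0: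
  assumes q: "cmod q > 1" and z: "z0 \<noteq> 0" "z1 \<noteq> 0" and Z: "(\<gamma>, \<mu>) \<in> Zalg" and \<gamma>q: "\<gamma> q * z0 = z1"
  shows "Zalg_aut (\<gamma>, \<mu>) \<in> Iso_P0 q z0 z1"
proof -
  let ?\<psi> = "Zalg_aut (\<gamma>, \<mu>)"
  have q0: "q \<noteq> 0" using q by auto
  have \<psi>: "?\<psi> \<in> Aut_R" by (rule Zalg_aut_in_Aut_R[OF Z])
  have "fibre_P0 z1 F * ?\<psi> A = ?\<psi> B * fibre_P0 z0 F"
    if A: "A \<in> objects" and B: "B \<in> objects" and F: "F \<in> hom_P0 q A B" for A B F
  proof -
    define n where "n = dim_row A"
    define m where "m = dim_row B"
    have A': "A \<in> carrier_mat n n" and B': "B \<in> carrier_mat m m"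
      unfolding n_def m_def by (rule objects_carrier[OF A], rule objects_carrier[OF B])
    have F': "F \<in> carrier_mat m n"
      using F by (simp add: hom_P0_def n_def m_def)
    define K where "K = {k. map_mat (\<lambda>f. fls_nth f k) F \<noteq> 0\<^sub>m m n}"
    have K: "finite K" unfolding K_def by (rule hom_P0_finite[OF q A A' B B' F])
    define X where "X k = map_mat (\<lambda>f. fls_nth f k) F" for k
    note X = hom_P0_coeff[OF q0 A' B' F, folded X_def]
    define \<alpha> where "\<alpha> = ?\<psi> A"
    define \<beta> where "\<beta> = ?\<psi> B"
    have \<alpha>: "\<alpha> \<in> carrier_mat n n" unfolding \<alpha>_def by (rule Aut_RD(1)[OF \<psi> A A'])
    have \<beta>: "\<beta> \<in> carrier_mat m m" unfolding \<beta>_def by (rule Aut_RD(1)[OF \<psi> B B'])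
    note [simp] = carrier_matD[OF F'] carrier_matD[OF \<alpha>] carrier_matD[OF \<beta>] carrier_matD[OF X(1)]
    have eval: "fibre_P0 z F = mat m n (\<lambda>(i, j). \<Sum>k\<in>K. X k $$ (i, j) * z powi k)" if "z \<noteq> 0" for z
    proof (intro eq_matI)
      fix i j assume "i < dim_row (mat m n (\<lambda>(i, j). \<Sum>k\<in>K. X k $$ (i, j) * z powi k))"
        "j < dim_col (mat m n (\<lambda>(i, j). \<Sum>k\<in>K. X k $$ (i, j) * z powi k))"
      then have ij: "i < m" "j < n" by auto
      have "fls_nth (F $$ (i, j)) k = 0" if "k \<notin> K" for k
      proof -
        have "X k $$ (i, j) = 0" using that ij by (simp add: K_def X_def[symmetric])
        then show ?thesis using ij by (simp add: X_def)
      qed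
      from eval_fls_finite_support[OF that K this]
      show "fibre_P0 z F $$ (i, j) = mat m n (\<lambda>(i, j). \<Sum>k\<in>K. X k $$ (i, j) * z powi k) $$ (i, j)"
        using ij by (simp add: fibre_P0_def X_def)
    qed (auto simp: fibre_P0_def)
    have X_nat: "\<gamma> q powi k \<cdot>\<^sub>m (X k * \<alpha>) = \<beta> * X k" for k
    proof -
      have qk: "q powi k \<noteq> 0" using q0 by simp
      have sc: "q powi k \<cdot>\<^sub>m 1\<^sub>m 1 \<in> objects" by (rule scalar_objects[OF qk])
      have tens: "kronecker (q powi k \<cdot>\<^sub>m 1\<^sub>m 1) A = q powi k \<cdot>\<^sub>m A" by (rule kronecker_scalar)
      have "?\<psi> (q powi k \<cdot>\<^sub>m A) = kronecker (?\<psi> (q powi k \<cdot>\<^sub>m 1\<^sub>m 1)) \<alpha>"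
        unfolding tens[symmetric] \<alpha>_def by (rule Aut_RD(4)[OF \<psi> sc A])
      also have "\<dots> = \<gamma> q powi k \<cdot>\<^sub>m \<alpha>"
        by (simp only: Zalg_aut_scalar[OF qk] ZalgD_powi[OF Z q0] kronecker_scalar)
      finally have tw: "?\<psi> (q powi k \<cdot>\<^sub>m A) = \<gamma> q powi k \<cdot>\<^sub>m \<alpha>" .
      have qA: "q powi k \<cdot>\<^sub>m A \<in> objects" "q powi k \<cdot>\<^sub>m A \<in> carrier_mat n n"
        using A'  kronecker_objects[OF sc A] by (simp_all only: tens smult_carrier_mat)
      have "X k * ?\<psi> (q powi k \<cdot>\<^sub>m A) = ?\<psi> B * X k"
        by (rule Aut_RD(3)[OF \<psi> qA(1) B qA(2) B' X(1,2)])
      then have "X k * (\<gamma> q powi k \<cdot>\<^sub>m \<alpha>) = \<beta> * X k" by (simp only: tw \<beta>_def)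
      then show ?thesis by (simp add: mult_smult_distrib[OF X(1) \<alpha>])
    qed
    have z1k: "z1 powi k = \<gamma> q powi k * z0 powi k" for k
      by (simp add: power_int_mult_distrib flip: \<gamma>q)
    have "fibre_P0 z1 F * \<alpha> = \<beta> * fibre_P0 z0 F"
    proof (intro eq_matI)
      fix i j assume "i < dim_row (\<beta> * fibre_P0 z0 F)" "j < dim_col (\<beta> * fibre_P0 z0 F)"
      then have ij: "i < m" "j < n" by (auto simp: fibre_P0_def)
      have "(fibre_P0 z1 F * \<alpha>) $$ (i, j) = (\<Sum>l<n. (\<Sum>k\<in>K. X k $$ (i, l) * z1 powi k) * \<alpha> $$ (l, j))"
        using ij by (subst index_mult_mat_sum) (auto simp: eval[OF z(2)])
      also have "\<dots> = (\<Sum>k\<in>K. z1 powi k * (\<Sum>l<n. X k $$ (i, l) * \<alpha> $$ (l, j)))"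
        unfolding sum_distrib_left sum_distrib_right by (subst sum.swap) (simp add: mult_ac)
      also have "\<dots> = (\<Sum>k\<in>K. z0 powi k * (\<gamma> q powi k \<cdot>\<^sub>m (X k * \<alpha>)) $$ (i, j))"
        using ij by (intro sum.cong refl) (simp add: z1k index_mult_mat_sum del: index_mult_mat(1))
      also have "\<dots> = (\<Sum>k\<in>K. z0 powi k * (\<Sum>l<m. \<beta> $$ (i, l) * X k $$ (l, j)))"
        using ij by (simp only: X_nat) (simp add: index_mult_mat_sum del: index_mult_mat(1))
      also have "\<dots> = (\<Sum>l<m. \<beta> $$ (i, l) * (\<Sum>k\<in>K. X k $$ (l, j) * z0 powi k))"
        unfolding sum_distrib_left by (subst sum.swap) (simp add: mult_ac)
      also have "\<dots> = (\<beta> * fibre_P0 z0 F) $$ (i, j)"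
        using ij by (subst index_mult_mat_sum) (auto simp: eval[OF z(1)])
      finally show "(fibre_P0 z1 F * \<alpha>) $$ (i, j) = (\<beta> * fibre_P0 z0 F) $$ (i, j)" .
    qed (auto simp: fibre_P0_def)
    then show ?thesis by (simp only: \<alpha>_def \<beta>_def)
  qed
  then show ?thesis
    using \<psi> unfolding Iso_P0_def Aut_R_def tensor_isos_def by blast
qed

text \<open>The function \<open>z\<close> is a morphism from \<open>(\<complex>, 1)\<close> to \<open>(\<complex>, q)\<close>; naturality with respect to it is the
  condition on \<open>\<gamma>\<close>.\<close>

lemma Zalg_aut_in_Iso_P0D:
  assumes q: "q \<noteq> 0" and Z: "(\<gamma>, \<mu>) \<in> Zalg" and Iso: "Zalg_aut (\<gamma>, \<mu>) \<in> Iso_P0 q z0 z1"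
  shows "\<gamma> q * z0 = z1"
proof -
  let ?F = "mat 1 1 (\<lambda>_. fls_X) :: complex fls mat"
  have sigma_X: "sigma q fls_X = fls_const q * fls_X"
    by (rule fls_eqI) (auto simp: fls_nth_sigma[OF q])
  have "?F \<in> hom_P0 q (1 \<cdot>\<^sub>m 1\<^sub>m 1) (q \<cdot>\<^sub>m 1\<^sub>m 1)"
    unfolding hom_P0_def mem_Collect_eq
  proof (intro conjI)
    show "elements_mat ?F \<subseteq> mero_germs" by (auto simp: elements_mat_def mero_germs_def)
    show "map_mat (sigma q) ?F * map_mat fls_const (1 \<cdot>\<^sub>m 1\<^sub>m 1) = map_mat fls_const (q \<cdot>\<^sub>m 1\<^sub>m 1) * ?F"
      by (intro eq_matI) (auto simp: scalar_prod_def sigma_X)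
  qed auto
  then have "fibre_P0 z1 ?F * Zalg_aut (\<gamma>, \<mu>) (1 \<cdot>\<^sub>m 1\<^sub>m 1) = Zalg_aut (\<gamma>, \<mu>) (q \<cdot>\<^sub>m 1\<^sub>m 1) * fibre_P0 z0 ?F"
    using Iso scalar_objects[of 1 1] scalar_objects[OF q, of 1]
    unfolding Iso_P0_def tensor_isos_def mem_Collect_eq by (metis one_neq_zero)
  then have "fibre_P0 z1 ?F * (1 \<cdot>\<^sub>m 1\<^sub>m 1) = (\<gamma> q \<cdot>\<^sub>m 1\<^sub>m 1) * fibre_P0 z0 ?F"
    by (simp only: Zalg_aut_scalar[OF q] Zalg_aut_scalar[OF one_neq_zero] ZalgD(3)[OF Z])
  from arg_cong[OF this, of "\<lambda>M. M $$ (0, 0)"] show ?thesis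
    by (simp add: fibre_P0_def scalar_prod_def)
qed

theorem mainTheorem1:
  fixes q z0 z1 :: complex
  assumes "cmod q > 1" and "z0 \<noteq> 0" and "z1 \<noteq> 0"
  shows "Iso_P0 q z0 z1 = Zalg_aut ` {(\<gamma>, \<mu>) \<in> Zalg. \<gamma> q * z0 = z1}"
proof (intro equalityI subsetI)
  fix \<phi> assume \<phi>: "\<phi> \<in> Iso_P0 q z0 z1"
  then have "\<phi> \<in> Zalg_aut ` Zalg"
    using Iso_P0_subset_Aut_R Aut_R_eq by blast
  then obtain \<gamma> \<mu> where Z: "(\<gamma>, \<mu>) \<in> Zalg" and eq: "\<phi> = Zalg_aut (\<gamma>, \<mu>)" by (metis imageE surj_pair)
  have "q \<noteq> 0" using assms(1) by auto
  with \<phi> Z have "\<gamma> q * z0 = z1" unfolding eq by (intro Zalg_aut_in_Iso_P0D)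
  with Z eq show "\<phi> \<in> Zalg_aut ` {(\<gamma>, \<mu>) \<in> Zalg. \<gamma> q * z0 = z1}" by blast
next
  fix \<phi> assume "\<phi> \<in> Zalg_aut ` {(\<gamma>, \<mu>) \<in> Zalg. \<gamma> q * z0 = z1}"
  then show "\<phi> \<in> Iso_P0 q z0 z1" using Zalg_aut_in_Iso_P0[OF assms] by (auto simp del: Zalg_aut.simps)
qed

end
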